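(* Consider the quadratic homogeneous (Halphen–Brioschi) system $$\dot x=x^2+\Xi,\qquad \dot y=y^2+\Xi,\qquad \dot z=z^2+\Xi,\qquad \Xi=\boldsymbol{a}\,(y-x)^2+\boldsymbol{b}\,(z-x)^2+\boldsymbol{c}\,(z-y)^2,$$ whose coefficients are computed from hypergeometric parameters $(a,b,c)$ by $$4\boldsymbol{a}=ac+bc-2ab-c,\qquad 4\boldsymbol{b}=a^2+b^2-ac-bc+c-1,\qquad 4\boldsymbol{c}=c^2+2ab-ac-bc-c .$$ 1. The system has the first integral $$J_1=CA\cdot{}_2F_1\Big(a,b;c\,\Big|\,\frac{z-x}{z-y}\Big)+CB\cdot{}_2F_1\Big(a+1,b+1;c+1\,\Big|\,\frac{z-x}{z-y}\Big),$$ where $$A=(a+b-1)x-cy-(a+b-c+1)z,\qquad B=2\,\frac{ab}{c}\,\frac{(x-y)(z-x)}{z-y},$$ $$C=(y-x)^{\frac12(a+b-c)}(z-y)^{-\frac12(a+b)}(z-x)^{\frac12(c-1)}.$$ 2. Assume that the second solution (linearly independent of $\Psi={}_2F_1(a,b;c|s)$) of the hypergeometric equation $$s(s-1)\Psi''+\{(a+b+1)s-c\}\Psi'+ab\,\Psi=0$$ has no logarithmic behavior in the vicinity of $s=0$, so that it may be taken in the form $\tilde\Psi=s^{1-c}(s-1)^{c-a-b}\,{}_2F_1(1-a,1-b;2-c|s)$. Then the system has the second integral $$J_2=\tilde C\tilde A\cdot{}_2F_1\Big(1-a,1-b;2-c\,\Big|\,\frac{z-x}{z-y}\Big)+\tilde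 C\tilde B\cdot{}_2F_1\Big(2-a,2-b;3-c\,\Big|\,\frac{z-x}{z-y}\Big),$$ where $$\tilde A=A+2(z+y),\qquad \tilde B=2\,\frac{(a-1)(b-1)}{c-2}\,\frac{(x-y)(z-x)}{z-y},\qquad \tilde C=\frac{C}{(z-y)^2}.$$
   Context: The dot denotes $d/d\tau$, the prime denotes $d/ds$, and ${}_2F_1(a,b;c|s)$ is the Gauss hypergeometric function. The bold coefficients $\boldsymbol{a},\boldsymbol{b},\boldsymbol{c}$ are distinct from the parameters $a,b,c$. A first integral is a (possibly multi-valued) function of $(x,y,z)$ that is constant along solutions. The system is related to the hypergeometric equation by $s=\frac{z-x}{z-y}$, $\tau=\tilde\Psi(s)/\Psi(s)$, $\dot s=(x-y)s$. If the no-logarithm assumption in part 2 fails at $s=0$, the variables $(x,y,z)$ can be reordered with the help of the transformation $s\mapsto 1-s$ or $s\mapsto s^{-1}$. If a logarithm is present at each of the points $s=0,1,\infty$, one is in the case $(a,b,c)=(\frac12,\frac12,1)$, which is equivalent, up to a simple linear change of variables, to the Darboux–Halphen system $\dot X=(Y+Z)X-YZ$, $\dot Y=(X+Z)Y-XZ$, $\dot Z=(X+Y)Z-XY$, whose integrals are given separately through complete elliptic integrals.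
   Formalization: The prefactor of J_2 is corrected from C/(z-y)^2 to C^{-1}/(z-y), since with the printed factor J_2 is not constant along solutions (e.g. a=1); c is assumed not to be 0,-1,-2,..., so that 2F1(a,b;c|s) is defined. *)

theory Defs
  imports "HOL-Analysis.Analysis"
begin

section \<open>The Gauss hypergeometric function and its analytic continuation\<close>

text \<open>
  Coefficients with a vanishing denominator Pochhammer symbol count as zero (division by zero).
  So for \<open>c\<close> in \<open>{0, -1, -2, \<dots>}\<close> this is the terminating series whenever the
  numerators vanish no later than the denominators, which is the usual convention.
\<close>

definition hyp2F1 :: "complex \<Rightarrow> complex \<Rightarrow> complex \<Rightarrow> complex \<Rightarrow> complex" where
  "hyp2F1 a b c s = eval_fps (fps_hypergeo [a, b] [c] 1) s"

text \<open>
  Simultaneous analytic continuation of a pair of function elements along chains of discs,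
  starting from the unit disc. The functions are relevant only on \<open>ball p r\<close>. Continuing the
  two functions as a pair ensures that they are always taken on the same sheet.
\<close>

inductive continued_pair ::
    "(complex \<Rightarrow> complex) \<Rightarrow> (complex \<Rightarrow> complex) \<Rightarrow>
     complex \<Rightarrow> real \<Rightarrow> (complex \<Rightarrow> complex) \<Rightarrow> (complex \<Rightarrow> complex) \<Rightarrow> bool"
  for f0 g0 where
  start: "continued_pair f0 g0 0 1 f0 g0"
| step: "continued_pair f0 g0 q \<rho> f' g'"
    if "continued_pair f0 g0 p r f g"
      and "ball p r \<inter> ball q \<rho> \<noteq> {}"
      and "f' holomorphic_on ball q \<rho>" and "g' holomorphic_on ball q \<rho>"
      and "\<And>s. s \<in> ball p r \<inter> ball q \<rho> \<Longrightarrow> f' s = f s \<and> g' s = g s"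

definition hypergeometric_sol ::
    "complex \<Rightarrow> complex \<Rightarrow> complex \<Rightarrow> complex set \<Rightarrow> (complex \<Rightarrow> complex) \<Rightarrow> bool" where
  "hypergeometric_sol a b c S \<Psi> \<longleftrightarrow> \<Psi> holomorphic_on S \<and>
     (\<forall>s\<in>S. s * (s - 1) * deriv (deriv \<Psi>) s + ((a + b + 1) * s - c) * deriv \<Psi> s
             + a * b * \<Psi> s = 0)"

definition second_solution ::
    "complex \<Rightarrow> complex \<Rightarrow> complex \<Rightarrow> complex set \<Rightarrow> (complex \<Rightarrow> complex) \<Rightarrow> bool" where
  "second_solution a b c S \<Phi> \<longleftrightarrow> hypergeometric_sol a b c S \<Phi> \<and>
     (\<forall>\<alpha> \<beta>. (\<forall>s\<in>S. \<alpha> * hyp2F1 a b c s + \<beta> * \<Phi> s = 0) \<longrightarrow> \<alpha> = 0 \<and> \<beta> = 0)"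

definition slit_disc :: "real \<Rightarrow> complex set" where
  "slit_disc r = ball 0 r - \<real>\<^sub>\<le>\<^sub>0"

text \<open>
  No logarithm at \<open>s = 0\<close>: near \<open>0\<close> a second solution is a pure Frobenius solution, that is, a
  power of \<open>s\<close> times a function that is holomorphic at \<open>0\<close>.
\<close>

definition no_log_at_0 :: "complex \<Rightarrow> complex \<Rightarrow> complex \<Rightarrow> bool" where
  "no_log_at_0 a b c \<longleftrightarrow>
     (\<exists>\<rho> h r. 0 < r \<and> r \<le> 1 \<and> h holomorphic_on ball 0 r \<and>
        second_solution a b c (slit_disc r) (\<lambda>s. s powr \<rho> * h s))"


section \<open>The Halphen--Brioschi system\<close>

definition coeff_a :: "complex \<Rightarrow> complex \<Rightarrow> complex \<Rightarrow> complex" where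
  "coeff_a a b c = (a * c + b * c - 2 * a * b - c) / 4"

definition coeff_b :: "complex \<Rightarrow> complex \<Rightarrow> complex \<Rightarrow> complex" where
  "coeff_b a b c = (a\<^sup>2 + b\<^sup>2 - a * c - b * c + c - 1) / 4"

definition coeff_c :: "complex \<Rightarrow> complex \<Rightarrow> complex \<Rightarrow> complex" where
  "coeff_c a b c = (c\<^sup>2 + 2 * a * b - a * c - b * c - c) / 4"

definition Xi ::
    "complex \<Rightarrow> complex \<Rightarrow> complex \<Rightarrow> complex \<Rightarrow> complex \<Rightarrow> complex \<Rightarrow> complex" where
  "Xi a b c x y z =
     coeff_a a b c * (y - x)\<^sup>2 + coeff_b a b c * (z - x)\<^sup>2 + coeff_c a b c * (z - y)\<^sup>2"

definition halphen_brioschi ::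
    "complex \<Rightarrow> complex \<Rightarrow> complex \<Rightarrow> complex set \<Rightarrow>
     (complex \<Rightarrow> complex) \<Rightarrow> (complex \<Rightarrow> complex) \<Rightarrow> (complex \<Rightarrow> complex) \<Rightarrow> bool" where
  "halphen_brioschi a b c T x y z \<longleftrightarrow>
     (\<forall>\<tau>\<in>T.
        (x has_field_derivative (x \<tau>)\<^sup>2 + Xi a b c (x \<tau>) (y \<tau>) (z \<tau>)) (at \<tau>) \<and>
        (y has_field_derivative (y \<tau>)\<^sup>2 + Xi a b c (x \<tau>) (y \<tau>) (z \<tau>)) (at \<tau>) \<and>
        (z has_field_derivative (z \<tau>)\<^sup>2 + Xi a b c (x \<tau>) (y \<tau>) (z \<tau>)) (at \<tau>))"


section \<open>Multi-valued functions of \<open>(x, y, z)\<close> and first integrals\<close>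

text \<open>A multi-valued function is given by the set of its branches \<open>J\<close> on open sets \<open>U\<close>.\<close>

type_synonym multifun =
  "((complex \<times> complex \<times> complex) set \<times> (complex \<times> complex \<times> complex \<Rightarrow> complex)) set"

text \<open>
  \<open>j\<close> is a determination of \<open>M\<close> along a curve: at every time it agrees locally with some branch.
  The branch may change from time to time, so \<open>j\<close> may follow \<open>M\<close> around its branch points.
\<close>

definition determination_along ::
    "multifun \<Rightarrow> complex set \<Rightarrow> (complex \<Rightarrow> complex) \<Rightarrow> (complex \<Rightarrow> complex) \<Rightarrow>
     (complex \<Rightarrow> complex) \<Rightarrow> (complex \<Rightarrow> complex) \<Rightarrow> bool" where
  "determination_along M T x y z j \<longleftrightarrow>
     (\<forall>\<tau>\<in>T. \<exists>(U, J)\<in>M. (x \<tau>, y \<tau>, z \<tau>) \<in> U \<and>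
               (\<forall>\<^sub>F t in nhds \<tau>. j t = J (x t, y t, z t)))"

definition first_integral :: "complex \<Rightarrow> complex \<Rightarrow> complex \<Rightarrow> multifun \<Rightarrow> bool" where
  "first_integral a b c M \<longleftrightarrow>
     (\<forall>T x y z j. open T \<and> connected T \<and> halphen_brioschi a b c T x y z \<and>
        determination_along M T x y z j \<longrightarrow> j constant_on T)"


section \<open>The two integrals\<close>

definition A :: "complex \<Rightarrow> complex \<Rightarrow> complex \<Rightarrow> complex \<Rightarrow> complex \<Rightarrow> complex \<Rightarrow> complex" where
  "A a b c x y z = (a + b - 1) * x - c * y - (a + b - c + 1) * z"

definition B :: "complex \<Rightarrow> complex \<Rightarrow> complex \<Rightarrow> complex \<Rightarrow> complex \<Rightarrow> complex \<Rightarrow> complex" where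
  "B a b c x y z = 2 * (a * b / c) * ((x - y) * (z - x) / (z - y))"

definition A_tilde ::
    "complex \<Rightarrow> complex \<Rightarrow> complex \<Rightarrow> complex \<Rightarrow> complex \<Rightarrow> complex \<Rightarrow> complex" where
  "A_tilde a b c x y z = A a b c x y z + 2 * (z + y)"

definition B_tilde ::
    "complex \<Rightarrow> complex \<Rightarrow> complex \<Rightarrow> complex \<Rightarrow> complex \<Rightarrow> complex \<Rightarrow> complex" where
  "B_tilde a b c x y z =
     2 * ((a - 1) * (b - 1) / (c - 2)) * ((x - y) * (z - x) / (z - y))"

text \<open>
  Branches of \<open>C = (y - x)\<^bsup>(a+b-c)/2\<^esup> (z - y)\<^bsup>-(a+b)/2\<^esup> (z - x)\<^bsup>(c-1)/2\<^esup>\<close> on \<open>U\<close>, one for each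
  choice of continuous logarithms. In particular \<open>x\<close>, \<open>y\<close>, \<open>z\<close> are pairwise distinct on \<open>U\<close>.
\<close>

definition C_branch ::
    "complex \<Rightarrow> complex \<Rightarrow> complex \<Rightarrow> (complex \<times> complex \<times> complex) set \<Rightarrow>
     (complex \<times> complex \<times> complex \<Rightarrow> complex) \<Rightarrow> bool" where
  "C_branch a b c U C \<longleftrightarrow>
     (\<exists>L1 L2 L3. continuous_on U L1 \<and> continuous_on U L2 \<and> continuous_on U L3 \<and>
        (\<forall>(x, y, z)\<in>U.
           exp (L1 (x, y, z)) = y - x \<and>
           exp (L2 (x, y, z)) = z - y \<and>
           exp (L3 (x, y, z)) = z - x \<and>
           C (x, y, z) = exp ((a + b - c) / 2 * L1 (x, y, z))
                       * exp (- (a + b) / 2 * L2 (x, y, z))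
                       * exp ((c - 1) / 2 * L3 (x, y, z))))"

definition J1 :: "complex \<Rightarrow> complex \<Rightarrow> complex \<Rightarrow> multifun" where
  "J1 a b c = {(U, J). open U \<and>
     (\<exists>C p r F G.
        C_branch a b c U C \<and>
        continued_pair (hyp2F1 a b c) (hyp2F1 (a + 1) (b + 1) (c + 1)) p r F G \<and>
        (\<forall>(x, y, z)\<in>U.
           (z - x) / (z - y) \<in> ball p r \<and>
           J (x, y, z) =
             C (x, y, z) * A a b c x y z * F ((z - x) / (z - y)) +
             C (x, y, z) * B a b c x y z * G ((z - x) / (z - y))))}"

text \<open>
  The prefactor of the second integral is \<open>C\<^bsup>-1\<^esup> / (z - y)\<close>. Up to constant factors it is
  \<open>s\<^bsup>1-c\<^esup> (s - 1)\<^bsup>c-a-b\<^esup> C\<close> with \<open>s = (z - x) / (z - y)\<close>, and also \<open>C\<close> with \<open>(a, b, c)\<close> replaced by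
  \<open>(1 - a, 1 - b, 2 - c)\<close>, a substitution that leaves the system invariant. The expression
  \<open>C / (z - y)\<^sup>2\<close> is a misprint for it: \<open>C\<^sup>2 / (z - y)\<close>, the ratio of the two, is not constant along
  solutions.
\<close>

definition J2 :: "complex \<Rightarrow> complex \<Rightarrow> complex \<Rightarrow> multifun" where
  "J2 a b c = {(U, J). open U \<and>
     (\<exists>C p r F G.
        C_branch a b c U C \<and>
        continued_pair (hyp2F1 (1 - a) (1 - b) (2 - c)) (hyp2F1 (2 - a) (2 - b) (3 - c)) p r F G \<and>
        (\<forall>(x, y, z)\<in>U.
           (z - x) / (z - y) \<in> ball p r \<and>
           (let C_tilde = inverse (C (x, y, z)) / (z - y) in
             J (x, y, z) =
               C_tilde * A_tilde a b c x y z * F ((z - x) / (z - y)) +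
               C_tilde * B_tilde a b c x y z * G ((z - x) / (z - y)))))}"

end

theory Submission
  imports Defs "HOL-Complex_Analysis.Complex_Analysis"
begin

text \<open>
  Along a solution of the system \<open>s = (z - x) / (z - y)\<close> satisfies \<open>s' = (x - y) s\<close>, and the prefactor
  \<open>C\<close> has the logarithmic derivative \<open>A / 2\<close>. For any function \<open>\<Psi>\<close> the expression
  \<open>C (A \<Psi>(s) + 2 (x - y) s \<Psi>'(s))\<close> is therefore \<open>2 d/d\<tau> (C \<Psi>(s))\<close>, and this is the first integral,
  because the derivative of \<open>\<^sub>2F\<^sub>1(a,b;c|s)\<close> is \<open>(a b / c) \<^sub>2F\<^sub>1(a+1,b+1;c+1|s)\<close>. Its constancy means
  that \<open>C \<Psi>(s)\<close> is an affine function of \<open>\<tau>\<close>, and indeed \<open>(C \<Psi>(s))''\<close> is a multiple of the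
  hypergeometric equation for \<open>\<Psi>\<close>: lemmas \<open>A_riccati\<close> and \<open>conserved_quantity\<close>. Only the differential
  equation and the relation between \<open>\<Psi>'\<close> and its companion enter. Both survive analytic
  continuation (\<open>continued_pair_invariant\<close>), and the computation is the same for every branch of \<open>C\<close>,
  so it covers the multi-valued function.

  The substitution of \<open>(1 - a, 1 - b, 2 - c)\<close> for \<open>(a, b, c)\<close> leaves \<open>\<Xi>\<close> unchanged and turns the
  first integral into minus the second one (\<open>first_integral_J2\<close>). It remains to see that the series
  \<open>\<^sub>2F\<^sub>1(1-a,1-b;2-c|s)\<close> solves its equation. This can fail only if \<open>2 - c = -n\<close> is an integer
  \<open>\<le> 0\<close>, and then the absence of a logarithm helps. A pure Frobenius solution independent of
  \<open>\<^sub>2F\<^sub>1(a,b;c|s)\<close> has exponent \<open>1 - c \<noteq> 0\<close> at \<open>0\<close>, and its recurrence passes the index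
  where it degenerates only if \<open>1 - a\<close> or \<open>1 - b\<close> lies in \<open>{0, -1, \<dots>, -n}\<close>; the series then breaks
  off in time (\<open>no_log_imp\<close>). Finally, multiplication by \<open>s\<^bsup>1-c\<^esup> (s - 1)\<^bsup>c-a-b\<^esup>\<close> maps solutions for
  the new parameters to solutions for the old ones (\<open>gauge_transformed_sol\<close>), and independence
  follows by comparing the exponents \<open>0\<close> and \<open>1 - c\<close> at \<open>0\<close> (\<open>independent_of_powr\<close>).
\<close>

section \<open>The hypergeometric series\<close>

declare fps_hypergeo_nth [simp del]

text \<open>
  If \<open>c + n = 0\<close>, both sides vanish, because a quotient with denominator zero is zero.
\<close>

lemma hypergeo_recurrence:
  fixes a b c :: complex
  defines "u \<equiv> fps_nth (fps_hypergeo [a, b] [c] 1)"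
  shows "u (Suc n) = (a + of_nat n) * (b + of_nat n) / (of_nat (Suc n) * (c + of_nat n)) * u n"
  unfolding u_def fps_hypergeo_rec by simp

lemma hypergeo_ratio_tendsto_1:
  fixes a b c :: complex
  shows "(\<lambda>n. (a + of_nat n) * (b + of_nat n) / (of_nat (Suc n) * (c + of_nat n))) \<longlonglongrightarrow> 1"
proof -
  have aux: "(\<lambda>n. p / of_nat n + 1) \<longlonglongrightarrow> (1::complex)" for p
    using tendsto_add[OF tendsto_mult[OF tendsto_const[of p] lim_inverse_n[where 'a=complex]] tendsto_const[of 1]]
    by (simp add: divide_inverse)
  have "(\<lambda>n. ((a / of_nat n + 1) * (b / of_nat n + 1)) / ((1 / of_nat n + 1) * (c / of_nat n + 1)))
          \<longlonglongrightarrow> 1 * 1 / (1 * (1::complex))"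
    by (intro tendsto_intros aux) simp
  moreover have "\<forall>\<^sub>F n in sequentially.
      ((a / of_nat n + 1) * (b / of_nat n + 1)) / ((1 / of_nat n + 1) * (c / of_nat n + 1)) =
      (a + of_nat n) * (b + of_nat n) / (of_nat (Suc n) * (c + of_nat n))"
    using eventually_gt_at_top[of 0]
  proof eventually_elim
    case (elim n)
    have "p / of_nat n + 1 = (p + of_nat n) / of_nat n" for p :: complex
      using elim by (simp add: field_simps)
    then show ?case using elim by (simp add: add.commute)
  qed
  ultimately show ?thesis
    using Lim_transform_eventually by fastforce
qed

text \<open>
  The ratio of successive coefficients tends to \<open>1\<close> for all parameters, so the ratio test also
  covers the series that break off.
\<close>

lemma fps_conv_radius_hypergeo:
  fixes a b c :: complex
  shows "fps_conv_radius (fps_hypergeo [a, b] [c] 1) \<ge> 1"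
  unfolding fps_conv_radius_def
proof (rule conv_radius_geI_ex')
  fix r :: real
  assume r: "0 < r" "ereal r < 1"
  let ?u = "fps_nth (fps_hypergeo [a, b] [c] 1)"
  let ?q = "\<lambda>n. (a + of_nat n) * (b + of_nat n) / (of_nat (Suc n) * (c + of_nat n))"
  from r have "r < 1" by simp
  then obtain q where q: "r < q" "q < 1" using dense by blast
  have "(\<lambda>n. norm (?q n) * r) \<longlonglongrightarrow> norm (1::complex) * r"
    by (intro tendsto_intros hypergeo_ratio_tendsto_1)
  with q(1) have "\<forall>\<^sub>F n in sequentially. norm (?q n) * r < q"
    by (intro order_tendstoD(2)[where y = "1 * r"]) auto
  then obtain N where N: "\<And>n. n \<ge> N \<Longrightarrow> norm (?q n) * r < q"
    by (auto simp: eventually_sequentially)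
  show "summable (\<lambda>n. ?u n * of_real r ^ n)"
  proof (rule summable_ratio_test[OF q(2)])
    fix n assume "n \<ge> N"
    have "norm (?u (Suc n) * of_real r ^ Suc n) = (norm (?q n) * r) * norm (?u n * of_real r ^ n)"
      unfolding hypergeo_recurrence norm_mult[of "?q n"] norm_mult norm_power using r(1) by simp
    also have "\<dots> \<le> q * norm (?u n * of_real r ^ n)"
      using N[OF \<open>n \<ge> N\<close>] by (intro mult_right_mono) auto
    finally show "norm (?u (Suc n) * of_real r ^ Suc n) \<le> q * norm (?u n * of_real r ^ n)" .
  qed
qed

lemma norm_less_conv_radius_hypergeo:
  "s \<in> ball 0 1 \<Longrightarrow> ereal (norm s) < fps_conv_radius (fps_hypergeo [a, b] [c] (1::complex))"
  using fps_conv_radius_hypergeo[of a b c]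
  by (metis dist_0_norm ereal_less(3) less_le_trans mem_ball)

lemma hyp2F1_eq_eval_fps: "hyp2F1 a b c = eval_fps (fps_hypergeo [a, b] [c] 1)"
  by (simp add: hyp2F1_def fun_eq_iff)

lemma has_fps_expansion_hyp2F1: "hyp2F1 a b c has_fps_expansion fps_hypergeo [a, b] [c] 1"
  unfolding hyp2F1_eq_eval_fps
  using norm_less_conv_radius_hypergeo[of 0 a b c]
  by (simp add: eval_fps_has_fps_expansion zero_ereal_def)

lemma holomorphic_on_hyp2F1: "hyp2F1 a b c holomorphic_on ball 0 1"
  unfolding hyp2F1_eq_eval_fps
  using norm_less_conv_radius_hypergeo[of _ a b c]
  by (auto intro!: holomorphic_on_eval_fps simp: in_eball_iff)

lemma hyp2F1_0: "hyp2F1 a b c 0 = 1"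
  by (simp add: hyp2F1_def eval_fps_at_0)

lemma fps_deriv_hypergeo:
  fixes a b c :: complex
  shows "fps_deriv (fps_hypergeo [a, b] [c] 1) =
         fps_const (a * b / c) * fps_hypergeo [a + 1, b + 1] [c + 1] 1"
proof (rule fps_ext)
  fix n
  have "of_nat (Suc n) \<noteq> (0::complex)" by (rule of_nat_neq_0)
  then show "fps_nth (fps_deriv (fps_hypergeo [a, b] [c] 1)) n =
        fps_nth (fps_const (a * b / c) * fps_hypergeo [a + 1, b + 1] [c + 1] 1) n"
    by (simp add: fps_hypergeo_nth pochhammer_rec del: of_nat_Suc mult_Suc)
qed

lemma deriv_hyp2F1:
  assumes "s \<in> ball 0 1"
  shows "deriv (hyp2F1 a b c) s = a * b / c * hyp2F1 (a + 1) (b + 1) (c + 1) s"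
proof -
  have "deriv (hyp2F1 a b c) s = eval_fps (fps_deriv (fps_hypergeo [a, b] [c] 1)) s"
    unfolding hyp2F1_eq_eval_fps
    using norm_less_conv_radius_hypergeo[OF assms, of a b c]
    by (simp add: DERIV_imp_deriv has_field_derivative_eval_fps)
  then show ?thesis
    using norm_less_conv_radius_hypergeo[OF assms, of "a + 1" "b + 1" "c + 1"]
    by (simp add: fps_deriv_hypergeo eval_fps_mult hyp2F1_def)
qed

text \<open>
  With \<open>c = -n\<close> the recurrence that the differential equation asks for divides by zero at index
  \<open>n\<close>. The series still solves the equation if a factor of the numerator vanishes no later than that.
\<close>

definition nondegenerate :: "complex \<Rightarrow> complex \<Rightarrow> complex \<Rightarrow> bool" where
  "nondegenerate a b c \<longleftrightarrow> (\<forall>n. c = - of_nat n \<longrightarrow> (\<exists>k\<le>n. a = - of_nat k \<or> b = - of_nat k))"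

text \<open>
  This form without division is the one that the differential equation imposes on coefficients.
  If \<open>c + n = 0\<close>, the left side is zero, and a factor \<open>a + k\<close> or \<open>b + k\<close> with \<open>k \<le> n\<close>
  annihilates the right side.
\<close>

lemma hypergeo_recurrence_nondegenerate:
  fixes a b c :: complex
  defines "u \<equiv> fps_nth (fps_hypergeo [a, b] [c] 1)"
  assumes "nondegenerate a b c"
  shows "of_nat (Suc n) * (c + of_nat n) * u (Suc n) = (a + of_nat n) * (b + of_nat n) * u n"
proof (cases "c + of_nat n = 0")
  case False
  have "of_nat (Suc n) \<noteq> (0::complex)" by (rule of_nat_neq_0)
  with False show ?thesis
    unfolding u_def hypergeo_recurrence by (simp del: of_nat_Suc fps_hypergeo_nth)
next
  case True
  then have "c = - of_nat n" by (simp add: eq_neg_iff_add_eq_0)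
  with assms(2) obtain k where k: "k \<le> n" "a = - of_nat k \<or> b = - of_nat k"
    unfolding nondegenerate_def by blast
  have "pochhammer a (Suc n) * pochhammer b (Suc n) = 0"
    using k by (auto simp: pochhammer_eq_0_iff intro!: exI[of _ k])
  then have "(a + of_nat n) * (b + of_nat n) * (pochhammer a n * pochhammer b n) = 0"
    unfolding pochhammer_Suc by (simp only: mult_ac)
  then show ?thesis
    using True by (auto simp: u_def fps_hypergeo_nth)
qed

text \<open>
  Near \<open>0\<close> the equation is the recurrence of the coefficients; it extends to the unit disc because
  its left side is holomorphic there.
\<close>

lemma hypergeometric_sol_hyp2F1:
  assumes "nondegenerate a b c"
  shows "hypergeometric_sol a b c (ball 0 1) (hyp2F1 a b c)"
proof -
  let ?F = "fps_hypergeo [a, b] [c] 1"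
  let ?E = "\<lambda>s. s * (s - 1) * deriv (deriv (hyp2F1 a b c)) s
      + ((a + b + 1) * s - c) * deriv (hyp2F1 a b c) s + a * b * hyp2F1 a b c s"
  let ?F' = "fps_deriv ?F" and ?F'' = "fps_deriv (fps_deriv ?F)"
  let ?H = "fps_X * (fps_X * ?F'') - fps_X * ?F'' + fps_const (a + b + 1) * (fps_X * ?F')
      - fps_const c * ?F' + fps_const (a * b) * ?F"
  have "?H = 0"
  proof (rule fps_ext)
    fix n
    note rec = hypergeo_recurrence_nondegenerate[OF assms, of n]
    show "fps_nth ?H n = fps_nth 0 n"
    proof (cases n)
      case 0
      then show ?thesis
        using rec by (simp add: algebra_simps)
    next
      case (Suc m)
      then show ?thesis using rec
        by (cases m) (simp_all add: algebra_simps)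
    qed
  qed
  moreover have "?E has_fps_expansion ?H"
  proof -
    have "(\<lambda>s. s * (s * deriv (deriv (hyp2F1 a b c)) s) - s * deriv (deriv (hyp2F1 a b c)) s
          + (a + b + 1) * (s * deriv (hyp2F1 a b c) s) - c * deriv (hyp2F1 a b c) s
          + a * b * hyp2F1 a b c s) has_fps_expansion ?H"
      by (intro fps_expansion_intros has_fps_expansion_hyp2F1)
    then show ?thesis by (simp add: algebra_simps)
  qed
  ultimately have "?E has_fps_expansion 0" by simp
  moreover have "?E holomorphic_on ball 0 1"
    by (intro holomorphic_intros holomorphic_on_hyp2F1) auto
  ultimately have "?E s = 0" if "s \<in> ball 0 1" for s
    using that by (intro has_fps_expansion_0_analytic_continuation[of ?E "ball 0 1"]) auto
  then show ?thesis
    unfolding hypergeometric_sol_def using holomorphic_on_hyp2F1 by blast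
qed

lemma hypergeometric_sol_derivatives:
  assumes "hypergeometric_sol a b c S F" "open S" "s \<in> S"
  shows "(F has_field_derivative deriv F s) (at s)"
    and "(deriv F has_field_derivative deriv (deriv F) s) (at s)"
    and "s * (s - 1) * deriv (deriv F) s + ((a + b + 1) * s - c) * deriv F s + a * b * F s = 0"
proof -
  have F: "F holomorphic_on S" using assms(1) by (simp add: hypergeometric_sol_def)
  then show "(F has_field_derivative deriv F s) (at s)"
    using assms(2,3) by (rule holomorphic_derivI)
  show "(deriv F has_field_derivative deriv (deriv F) s) (at s)"
    using holomorphic_deriv[OF F assms(2)] assms(2,3) by (rule holomorphic_derivI)
qed (use assms in \<open>auto simp: hypergeometric_sol_def\<close>)

section \<open>Analytic continuation\<close>

text \<open>
  Differential relations are permanent: on the overlap of two discs old and new elements have the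
  same derivatives, and the identity theorem carries the relations to the whole new disc.
\<close>

lemma continued_pair_invariant:
  assumes "continued_pair f0 g0 p r f g"
    and start: "hypergeometric_sol a b c (ball 0 1) f0" "g0 holomorphic_on ball 0 1"
      "\<And>s. s \<in> ball 0 1 \<Longrightarrow> deriv f0 s = \<kappa> * g0 s"
  shows "hypergeometric_sol a b c (ball p r) f \<and> g holomorphic_on ball p r \<and>
    (\<forall>s\<in>ball p r. deriv f s = \<kappa> * g s)"
  using assms(1)
proof induction
  case start
  then show ?case using assms by blast
next
  case (step p r f g q \<rho> f' g')
  let ?I = "ball p r \<inter> ball q \<rho>"
  let ?E = "\<lambda>s. s * (s - 1) * deriv (deriv f') s + ((a + b + 1) * s - c) * deriv f' s + a * b * f' s"
  have "open ?I" by blast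
  have ev: "\<forall>\<^sub>F t in nhds s. f' t = f t" if "s \<in> ?I" for s
    using eventually_nhds_in_open[OF \<open>open ?I\<close> that] by eventually_elim (use step.hyps in auto)
  have d1: "deriv f' s = deriv f s" if "s \<in> ?I" for s
    using ev[OF that] by (intro deriv_cong_ev) auto
  have "\<forall>\<^sub>F t in nhds s. deriv f' t = deriv f t" if "s \<in> ?I" for s
    using eventually_nhds_in_open[OF \<open>open ?I\<close> that] by eventually_elim (use d1 in auto)
  then have d2: "deriv (deriv f') s = deriv (deriv f) s" if "s \<in> ?I" for s
    using that by (intro deriv_cong_ev) auto
  have "?E s = 0" if "s \<in> ball q \<rho>" for s
  proof (rule analytic_continuation_open[of ?I "ball q \<rho>" ?E "\<lambda>_. 0"])
    show "?E holomorphic_on ball q \<rho>"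
      by (intro holomorphic_intros step.hyps) auto
    fix s assume "s \<in> ?I"
    then show "?E s = 0"
      using step.IH step.hyps(5) d1 d2 by (auto simp: hypergeometric_sol_def)
  qed (use that step.hyps in auto)
  moreover have "deriv f' s = \<kappa> * g' s" if "s \<in> ball q \<rho>" for s
  proof (rule analytic_continuation_open[of ?I "ball q \<rho>" "deriv f'" "\<lambda>s. \<kappa> * g' s"])
    show "deriv f' holomorphic_on ball q \<rho>" "(\<lambda>s. \<kappa> * g' s) holomorphic_on ball q \<rho>"
      by (intro holomorphic_intros step.hyps; simp)+
    fix s assume "s \<in> ?I"
    then show "deriv f' s = \<kappa> * g' s"
      using step.IH step.hyps(5) d1 by auto
  qed (use that step.hyps in auto)
  ultimately show ?case
    using step.hyps by (simp add: hypergeometric_sol_def)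
qed

lemma continued_hyp2F1:
  assumes "nondegenerate a b c"
    and "continued_pair (hyp2F1 a b c) (hyp2F1 (a + 1) (b + 1) (c + 1)) p r F G"
  shows "hypergeometric_sol a b c (ball p r) F"
    and "s \<in> ball p r \<Longrightarrow> deriv F s = a * b / c * G s"
  using continued_pair_invariant[OF assms(2) hypergeometric_sol_hyp2F1[OF assms(1)]
      holomorphic_on_hyp2F1 deriv_hyp2F1] by blast+

section \<open>The prefactor and its logarithmic derivative\<close>

text \<open>
  Near \<open>\<tau>\<close> a continuous logarithm differs from \<open>L \<tau>\<close> by less than \<open>\<pi>\<close>, so it is
  \<open>L \<tau> + Ln (f t / f \<tau>)\<close> with the principal branch, which is differentiable at \<open>1\<close>.
\<close>

lemma has_field_derivative_continuous_log:
  fixes f L :: "complex \<Rightarrow> complex"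
  assumes "\<forall>\<^sub>F t in nhds \<tau>. exp (L t) = f t" "isCont L \<tau>" "(f has_field_derivative f') (at \<tau>)"
  shows "(L has_field_derivative f' / f \<tau>) (at \<tau>)"
proof -
  have f\<tau>: "exp (L \<tau>) = f \<tau>" using assms(1) by (rule eventually_nhds_x_imp_x)
  then have nz: "f \<tau> \<noteq> 0" by (metis exp_not_eq_zero)
  have "(L \<longlongrightarrow> L \<tau>) (nhds \<tau>)"
    using assms(2) unfolding isCont_def tendsto_at_iff_tendsto_nhds .
  from tendstoD[OF this pi_gt_zero] have "\<forall>\<^sub>F t in nhds \<tau>. dist (L t) (L \<tau>) < pi" .
  with assms(1) have ev: "\<forall>\<^sub>F t in nhds \<tau>. L \<tau> + Ln (f t / f \<tau>) = L t"
  proof eventually_elim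
    case (elim t)
    have "\<bar>Im (L t - L \<tau>)\<bar> < pi"
      using elim(2) abs_Im_le_cmod[of "L t - L \<tau>"] by (simp add: dist_norm)
    then have "Ln (exp (L t - L \<tau>)) = L t - L \<tau>" by (intro Ln_exp) auto
    then show ?case using elim(1) f\<tau> by (simp add: exp_diff)
  qed
  have "((\<lambda>t. L \<tau> + Ln (f t / f \<tau>)) has_field_derivative f' / f \<tau>) (at \<tau>)"
    by (rule derivative_eq_intros assms(3) refl | use nz in simp)+
  then show ?thesis
    using DERIV_cong_ev[OF refl ev refl] by blast
qed

text \<open>
  Along a solution of the system \<open>(y - x)' = y\<^sup>2 - x\<^sup>2\<close>, so the logarithms of \<open>y - x\<close>,
  \<open>z - y\<close> and \<open>z - x\<close> have the derivatives \<open>x + y\<close>, \<open>z + y\<close> and \<open>z + x\<close>. The left side is therefore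
  the logarithmic derivative of the prefactor.
\<close>

lemma A_eq_log_derivative:
  "(a + b - c) / 2 * (x + y) - (a + b) / 2 * (z + y) + (c - 1) / 2 * (z + x) = A a b c x y z / 2"
  unfolding A_def by (simp add: field_simps)

text \<open>
  The polynomial identity behind the first integral. If \<open>C' = C A / 2\<close>, then
  \<open>4 C'' = C (A\<^sup>2 + 2 A')\<close>; this must match the term \<open>a b \<Psi>\<close> of the hypergeometric equation. The
  coefficients of \<open>\<Xi>\<close> are chosen to make it so. In the coordinates \<open>s\<close> and \<open>w = z - y\<close> all
  differences become multiples of \<open>w\<close>.
\<close>

lemma A_riccati:
  fixes a b c w z s :: complex
  defines "y \<equiv> z - w" and "x \<equiv> z - s * w"
  shows "(A a b c x y z)\<^sup>2 + 2 * ((a + b - 1) * (x\<^sup>2 + Xi a b c x y z)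
      - c * (y\<^sup>2 + Xi a b c x y z) - (a + b - c + 1) * (z\<^sup>2 + Xi a b c x y z))
    = 4 * (a * b * s * (s - 1) * w\<^sup>2)"
proof -
  define X where "X = (a * c + b * c - 2 * a * b - c) * (s - 1)\<^sup>2
      + (a\<^sup>2 + b\<^sup>2 - a * c - b * c + c - 1) * s\<^sup>2 + (c\<^sup>2 + 2 * a * b - a * c - b * c - c)"
  have d: "y - x = w * (s - 1)" "z - x = w * s" "z - y = w"
    unfolding x_def y_def by (simp_all add: algebra_simps)
  have quarters: "4 * (p / 4 * u + q / 4 * v + r / 4 * t) = p * u + q * v + r * t"
    for p q r u v t :: complex by simp
  have Xi: "4 * Xi a b c x y z = w\<^sup>2 * X"
    unfolding Xi_def d coeff_a_def coeff_b_def coeff_c_def quarters X_def power_mult_distrib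
    by (simp only: distrib_left mult_ac)
  have A: "A a b c x y z = - 2 * z - w * ((a + b - 1) * s - c)"
    unfolding A_def x_def y_def by (simp add: algebra_simps)
  have "(A a b c x y z)\<^sup>2 + 2 * ((a + b - 1) * (x\<^sup>2 + Xi a b c x y z)
      - c * (y\<^sup>2 + Xi a b c x y z) - (a + b - c + 1) * (z\<^sup>2 + Xi a b c x y z))
    = (A a b c x y z)\<^sup>2 + 2 * ((a + b - 1) * x\<^sup>2 - c * y\<^sup>2 - (a + b - c + 1) * z\<^sup>2)
      - 4 * Xi a b c x y z"
    by (simp add: ring_distribs)
  also have "\<dots> = 4 * (a * b * s * (s - 1) * w\<^sup>2)"
    unfolding Xi A unfolding X_def x_def y_def power2_eq_square by (simp add: algebra_simps)
  finally show ?thesis .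
qed

section \<open>The conserved quantity\<close>

text \<open>
  The bracket times \<open>C\<close> is \<open>2 (C F(s))'\<close>, because \<open>C' = C A / 2\<close> and \<open>s' = (x - y) s\<close>. Its
  derivative \<open>2 (C F(s))''\<close> is \<open>C\<close> times a linear combination of \<open>F\<close>, \<open>F'\<close> and \<open>F''\<close>, whose
  coefficients are the common multiple \<open>2 w\<^sup>2 s (s - 1)\<close> of those of the hypergeometric equation.
\<close>

lemma conserved_quantity:
  fixes x y z C F :: "complex \<Rightarrow> complex"
  assumes system: "halphen_brioschi a b c T x y z" and \<tau>: "\<tau> \<in> T"
    and F: "hypergeometric_sol a b c S F" "open S" "(z \<tau> - x \<tau>) / (z \<tau> - y \<tau>) \<in> S"
    and "y \<tau> \<noteq> z \<tau>"
    and C: "(C has_field_derivative C \<tau> * (A a b c (x \<tau>) (y \<tau>) (z \<tau>) / 2)) (at \<tau>)"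
  shows "((\<lambda>t. C t * (A a b c (x t) (y t) (z t) * F ((z t - x t) / (z t - y t))
            + 2 * ((x t - y t) * (z t - x t) / (z t - y t)) * deriv F ((z t - x t) / (z t - y t))))
          has_field_derivative 0) (at \<tau>)"
proof -
  define s where "s = (z \<tau> - x \<tau>) / (z \<tau> - y \<tau>)"
  define w where "w = z \<tau> - y \<tau>"
  define X where "X = Xi a b c (x \<tau>) (y \<tau>) (z \<tau>)"
  define d where "d = x \<tau> - y \<tau>"
  define A\<tau> where "A\<tau> = A a b c (x \<tau>) (y \<tau>) (z \<tau>)"
  define A' where "A' = (a + b - 1) * ((x \<tau>)\<^sup>2 + X) - c * ((y \<tau>)\<^sup>2 + X)
      - (a + b - c + 1) * ((z \<tau>)\<^sup>2 + X)"
  define F0 F1 F2 where "F0 = F s" and "F1 = deriv F s" and "F2 = deriv (deriv F) s"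
  have w: "w \<noteq> 0" using assms(6) by (simp add: w_def)
  \<comment> \<open>In the coordinates \<open>z\<close>, \<open>w\<close>, \<open>s\<close> the variable \<open>z\<close> cancels from both coefficients below.\<close>
  have y_eq: "y \<tau> = z \<tau> - w" by (simp add: w_def)
  have x_eq: "x \<tau> = z \<tau> - s * w" using w by (simp add: s_def w_def)
  have d_eq: "d = - w * (s - 1)" by (simp add: d_def x_eq y_eq algebra_simps)
  have x': "(x has_field_derivative (x \<tau>)\<^sup>2 + X) (at \<tau>)"
    and y': "(y has_field_derivative (y \<tau>)\<^sup>2 + X) (at \<tau>)"
    and z': "(z has_field_derivative (z \<tau>)\<^sup>2 + X) (at \<tau>)"
    using system \<tau> by (auto simp: halphen_brioschi_def X_def)
  have s': "((\<lambda>t. (z t - x t) / (z t - y t)) has_field_derivative d * s) (at \<tau>)"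
  proof -
    have "((\<lambda>t. (z t - x t) / (z t - y t)) has_field_derivative
        (((z \<tau>)\<^sup>2 + X - ((x \<tau>)\<^sup>2 + X)) * (z \<tau> - y \<tau>)
          - (z \<tau> - x \<tau>) * ((z \<tau>)\<^sup>2 + X - ((y \<tau>)\<^sup>2 + X))) / ((z \<tau> - y \<tau>) * (z \<tau> - y \<tau>))) (at \<tau>)"
      using w unfolding w_def by (intro DERIV_divide DERIV_diff x' y' z') auto
    moreover have "(((z \<tau>)\<^sup>2 + X - ((x \<tau>)\<^sup>2 + X)) * (z \<tau> - y \<tau>)
          - (z \<tau> - x \<tau>) * ((z \<tau>)\<^sup>2 + X - ((y \<tau>)\<^sup>2 + X))) = d * s * (w * w)"
      unfolding d_def x_eq y_eq by (simp add: algebra_simps power2_eq_square)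
    ultimately show ?thesis using w by (simp add: w_def)
  qed
  have ds': "((\<lambda>t. (x t - y t) * ((z t - x t) / (z t - y t))) has_field_derivative
      (x \<tau> + y \<tau>) * d * s + d * (d * s)) (at \<tau>)"
    by (rule derivative_eq_intros x' y' s' refl)+
       (simp add: s_def d_def algebra_simps power2_eq_square)
  have A_deriv: "((\<lambda>t. A a b c (x t) (y t) (z t)) has_field_derivative A') (at \<tau>)"
    unfolding A_def A'_def by (intro DERIV_diff DERIV_cmult x' y' z')
  note Fd = hypergeometric_sol_derivatives[OF F, folded s_def]
  have F0': "((\<lambda>t. F ((z t - x t) / (z t - y t))) has_field_derivative F1 * (d * s)) (at \<tau>)"
    and F1': "((\<lambda>t. deriv F ((z t - x t) / (z t - y t))) has_field_derivative F2 * (d * s)) (at \<tau>)"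
    unfolding F1_def F2_def
    using DERIV_chain2[OF _ s', of F] DERIV_chain2[OF _ s', of "deriv F"] Fd(1,2)
    unfolding s_def by blast+
  have deriv: "((\<lambda>t. C t * (A a b c (x t) (y t) (z t) * F ((z t - x t) / (z t - y t))
            + 2 * ((x t - y t) * ((z t - x t) / (z t - y t))) * deriv F ((z t - x t) / (z t - y t))))
          has_field_derivative
       C \<tau> * (A\<tau> / 2) * (A\<tau> * F0 + 2 * (d * s) * F1)
       + C \<tau> * (A' * F0 + A\<tau> * (F1 * (d * s))
           + (2 * ((x \<tau> + y \<tau>) * d * s + d * (d * s)) * F1 + 2 * (d * s) * (F2 * (d * s))))) (at \<tau>)"
    by (rule derivative_eq_intros C A_deriv F0' F1' ds' refl)+
       (simp add: s_def d_def F0_def F1_def A\<tau>_def algebra_simps)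
  have "A\<tau>\<^sup>2 + 2 * A' = 4 * (a * b * s * (s - 1) * w\<^sup>2)"
    using A_riccati[of a b c "z \<tau>" s w] unfolding A\<tau>_def A'_def X_def x_eq y_eq .
  then have F0_coeff: "A\<tau> / 2 * A\<tau> + A' = 2 * w\<^sup>2 * s * (s - 1) * (a * b)"
    by (simp add: power2_eq_square field_simps)
  have F1_coeff: "2 * A\<tau> + 2 * (x \<tau> + y \<tau> + d) = - 2 * w * ((a + b + 1) * s - c)"
    unfolding A\<tau>_def A_def d_def x_eq y_eq by (simp add: algebra_simps)
  have "C \<tau> * (A\<tau> / 2) * (A\<tau> * F0 + 2 * (d * s) * F1)
       + C \<tau> * (A' * F0 + A\<tau> * (F1 * (d * s))
           + (2 * ((x \<tau> + y \<tau>) * d * s + d * (d * s)) * F1 + 2 * (d * s) * (F2 * (d * s))))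
     = C \<tau> * ((A\<tau> / 2 * A\<tau> + A') * F0 + d * s * (2 * A\<tau> + 2 * (x \<tau> + y \<tau> + d)) * F1
         + 2 * (d * s) * (d * s) * F2)"
    by (simp add: algebra_simps)
  also have "\<dots> = C \<tau> * (2 * w\<^sup>2 * s * (s - 1)) *
      (s * (s - 1) * F2 + ((a + b + 1) * s - c) * F1 + a * b * F0)"
    unfolding F0_coeff F1_coeff unfolding d_eq power2_eq_square by (simp add: algebra_simps)
  also have "\<dots> = 0"
    using Fd(3) unfolding F0_def F1_def F2_def by simp
  finally show ?thesis using deriv by simp
qed

section \<open>The two first integrals\<close>

lemma has_field_derivative_eventually_eq:
  assumes "\<forall>\<^sub>F t in nhds x. f t = g t" "(g has_field_derivative D) (at x)"
  shows "(f has_field_derivative D) (at x)"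
  using DERIV_cong_ev[OF refl assms(1) refl] assms(2) by blast

text \<open>
  A determination may change its branch in time, but it is locally a branch; vanishing derivatives
  of all branches make it constant on a connected set of times.
\<close>

lemma first_integralI:
  assumes "\<And>U J T x y z \<tau>. (U, J) \<in> M \<Longrightarrow> halphen_brioschi a b c T x y z \<Longrightarrow> \<tau> \<in> T \<Longrightarrow>
      (x \<tau>, y \<tau>, z \<tau>) \<in> U \<Longrightarrow> ((\<lambda>t. J (x t, y t, z t)) has_field_derivative 0) (at \<tau>)"
  shows "first_integral a b c M"
  unfolding first_integral_def
proof (intro allI impI, elim conjE)
  fix T x y z j
  assume T: "open T" "connected T" and sol: "halphen_brioschi a b c T x y z"
    and det: "determination_along M T x y z j"
  have "(j has_field_derivative 0) (at \<tau>)" if \<tau>: "\<tau> \<in> T" for \<tau>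
  proof -
    obtain U J where UJ: "(U, J) \<in> M" "(x \<tau>, y \<tau>, z \<tau>) \<in> U"
        "\<forall>\<^sub>F t in nhds \<tau>. j t = J (x t, y t, z t)"
      using det \<tau> unfolding determination_along_def by blast
    show ?thesis
      using assms[OF UJ(1) sol \<tau> UJ(2)] DERIV_cong_ev[OF refl UJ(3) refl] by blast
  qed
  then show "j constant_on T"
    using T by (intro has_field_derivative_0_imp_constant_on)
qed

lemma halphen_brioschi_eventually_in:
  assumes "halphen_brioschi a b c T x y z" "\<tau> \<in> T" "open U" "(x \<tau>, y \<tau>, z \<tau>) \<in> U"
  shows "isCont (\<lambda>t. (x t, y t, z t)) \<tau>" "\<forall>\<^sub>F t in nhds \<tau>. (x t, y t, z t) \<in> U"
proof -
  have "isCont x \<tau>" "isCont y \<tau>" "isCont z \<tau>"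
    using assms(1,2) DERIV_isCont unfolding halphen_brioschi_def by blast+
  then show "isCont (\<lambda>t. (x t, y t, z t)) \<tau>" by (intro continuous_intros)
  then show "\<forall>\<^sub>F t in nhds \<tau>. (x t, y t, z t) \<in> U"
    using assms(3,4) unfolding continuous_at_open eventually_nhds by blast
qed

text \<open>
  A branch of \<open>C\<close> is a product of exponentials of continuous logarithms, so it is differentiable
  along solutions, whichever branch it is.
\<close>

lemma C_branch_log_derivative:
  assumes sol: "halphen_brioschi a b c T x y z" and \<tau>: "\<tau> \<in> T"
    and U: "open U" "(x \<tau>, y \<tau>, z \<tau>) \<in> U" and "C_branch a b c U C"
  shows "((\<lambda>t. C (x t, y t, z t)) has_field_derivative
            C (x \<tau>, y \<tau>, z \<tau>) * (A a b c (x \<tau>) (y \<tau>) (z \<tau>) / 2)) (at \<tau>)"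
    and "C (x \<tau>, y \<tau>, z \<tau>) \<noteq> 0" and "y \<tau> \<noteq> z \<tau>"
proof -
  define X where "X = Xi a b c (x \<tau>) (y \<tau>) (z \<tau>)"
  obtain L1 L2 L3 where L: "continuous_on U L1" "continuous_on U L2" "continuous_on U L3"
    and "\<forall>(x, y, z)\<in>U. exp (L1 (x, y, z)) = y - x \<and> exp (L2 (x, y, z)) = z - y \<and>
      exp (L3 (x, y, z)) = z - x \<and> C (x, y, z) = exp ((a + b - c) / 2 * L1 (x, y, z))
        * exp (- (a + b) / 2 * L2 (x, y, z)) * exp ((c - 1) / 2 * L3 (x, y, z))"
    using assms(5) unfolding C_branch_def by blast
  then have eL: "exp (L1 (u, v, w)) = v - u" "exp (L2 (u, v, w)) = w - v" "exp (L3 (u, v, w)) = w - u"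
    and C: "C (u, v, w) = exp ((a + b - c) / 2 * L1 (u, v, w))
        * exp (- (a + b) / 2 * L2 (u, v, w)) * exp ((c - 1) / 2 * L3 (u, v, w))"
    if "(u, v, w) \<in> U" for u v w
    using that by auto
  note near = halphen_brioschi_eventually_in[OF sol \<tau> U]
  have xyz': "(x has_field_derivative (x \<tau>)\<^sup>2 + X) (at \<tau>)"
    "(y has_field_derivative (y \<tau>)\<^sup>2 + X) (at \<tau>)" "(z has_field_derivative (z \<tau>)\<^sup>2 + X) (at \<tau>)"
    using sol \<tau> by (auto simp: halphen_brioschi_def X_def)
  have log': "((\<lambda>t. L (x t, y t, z t)) has_field_derivative v \<tau> + u \<tau>) (at \<tau>)"
    if "continuous_on U L" "\<forall>\<^sub>F t in nhds \<tau>. exp (L (x t, y t, z t)) = v t - u t"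
      "(u has_field_derivative (u \<tau>)\<^sup>2 + X) (at \<tau>)" "(v has_field_derivative (v \<tau>)\<^sup>2 + X) (at \<tau>)"
    for L u v
  proof -
    have "isCont L (x \<tau>, y \<tau>, z \<tau>)"
      using that(1) U by (simp add: continuous_on_eq_continuous_at)
    then have "isCont (\<lambda>t. L (x t, y t, z t)) \<tau>"
      using isCont_o2[OF near(1)] by blast
    moreover have "((\<lambda>t. v t - u t) has_field_derivative (v \<tau>)\<^sup>2 + X - ((u \<tau>)\<^sup>2 + X)) (at \<tau>)"
      by (intro DERIV_diff that)
    ultimately have "((\<lambda>t. L (x t, y t, z t)) has_field_derivative
        ((v \<tau>)\<^sup>2 + X - ((u \<tau>)\<^sup>2 + X)) / (v \<tau> - u \<tau>)) (at \<tau>)"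
      using has_field_derivative_continuous_log[OF that(2)] by blast
    moreover have "v \<tau> - u \<tau> \<noteq> 0"
      using eventually_nhds_x_imp_x[OF that(2)] by (metis exp_not_eq_zero)
    moreover have "(v \<tau>)\<^sup>2 + X - ((u \<tau>)\<^sup>2 + X) = (v \<tau> + u \<tau>) * (v \<tau> - u \<tau>)"
      by (simp add: algebra_simps power2_eq_square)
    ultimately show ?thesis by simp
  qed
  have L1': "((\<lambda>t. L1 (x t, y t, z t)) has_field_derivative y \<tau> + x \<tau>) (at \<tau>)"
    by (rule log'[OF L(1) _ xyz'(1,2)], rule eventually_mono[OF near(2)]) (rule eL)
  have L2': "((\<lambda>t. L2 (x t, y t, z t)) has_field_derivative z \<tau> + y \<tau>) (at \<tau>)"
    by (rule log'[OF L(2) _ xyz'(2,3)], rule eventually_mono[OF near(2)]) (rule eL)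
  have L3': "((\<lambda>t. L3 (x t, y t, z t)) has_field_derivative z \<tau> + x \<tau>) (at \<tau>)"
    by (rule log'[OF L(3) _ xyz'(1,3)], rule eventually_mono[OF near(2)]) (rule eL)
  define p q r where "p = (a + b - c) / 2" and "q = - (a + b) / 2" and "r = (c - 1) / 2"
  note C = C[folded p_def q_def r_def]
  have q: "q = - ((a + b) / 2)" by (simp add: q_def field_simps)
  have sum: "p * (y \<tau> + x \<tau>) + q * (z \<tau> + y \<tau>) + r * (z \<tau> + x \<tau>)
      = A a b c (x \<tau>) (y \<tau>) (z \<tau>) / 2"
    unfolding A_eq_log_derivative[symmetric] q p_def r_def by (simp add: add.commute)
  show "((\<lambda>t. C (x t, y t, z t)) has_field_derivative
            C (x \<tau>, y \<tau>, z \<tau>) * (A a b c (x \<tau>) (y \<tau>) (z \<tau>) / 2)) (at \<tau>)"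
  proof (rule has_field_derivative_eventually_eq)
    show "\<forall>\<^sub>F t in nhds \<tau>. C (x t, y t, z t) =
        exp (p * L1 (x t, y t, z t)) * exp (q * L2 (x t, y t, z t)) * exp (r * L3 (x t, y t, z t))"
      by (rule eventually_mono[OF near(2)]) (rule C)
    show "((\<lambda>t. exp (p * L1 (x t, y t, z t)) * exp (q * L2 (x t, y t, z t))
        * exp (r * L3 (x t, y t, z t))) has_field_derivative
      C (x \<tau>, y \<tau>, z \<tau>) * (A a b c (x \<tau>) (y \<tau>) (z \<tau>) / 2)) (at \<tau>)"
      unfolding sum[symmetric] C[OF U(2)]
      by (rule derivative_eq_intros L1' L2' L3' refl)+ (simp add: algebra_simps)
  qed
  show "C (x \<tau>, y \<tau>, z \<tau>) \<noteq> 0"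
    unfolding C[OF U(2)] by simp
  show "y \<tau> \<noteq> z \<tau>"
    using eL(2)[OF U(2)] by (metis exp_not_eq_zero right_minus_eq)
qed

lemma first_integral_J1:
  assumes "nondegenerate a b c"
  shows "first_integral a b c (J1 a b c)"
proof (rule first_integralI)
  fix U J T x y z \<tau>
  assume UJ: "(U, J) \<in> J1 a b c" and sol: "halphen_brioschi a b c T x y z" and \<tau>: "\<tau> \<in> T"
    and in_U: "(x \<tau>, y \<tau>, z \<tau>) \<in> U"
  obtain C p r F G where U: "open U" and C: "C_branch a b c U C"
    and FG: "continued_pair (hyp2F1 a b c) (hyp2F1 (a + 1) (b + 1) (c + 1)) p r F G"
    and J: "\<And>x y z. (x, y, z) \<in> U \<Longrightarrow> (z - x) / (z - y) \<in> ball p r \<and>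
           J (x, y, z) =
             C (x, y, z) * A a b c x y z * F ((z - x) / (z - y)) +
             C (x, y, z) * B a b c x y z * G ((z - x) / (z - y))"
    using UJ unfolding J1_def by blast
  note Cd = C_branch_log_derivative[OF sol \<tau> U in_U C]
  note F = continued_hyp2F1[OF assms FG]
  have deriv: "((\<lambda>t. C (x t, y t, z t) * (A a b c (x t) (y t) (z t) * F ((z t - x t) / (z t - y t))
            + 2 * ((x t - y t) * (z t - x t) / (z t - y t)) * deriv F ((z t - x t) / (z t - y t))))
          has_field_derivative 0) (at \<tau>)"
    using conserved_quantity[OF sol \<tau> F(1) open_ball _ Cd(3), where C = "\<lambda>t. C (x t, y t, z t)"]
      J[OF in_U] Cd(1) by blast
  have J_eq: "\<forall>\<^sub>F t in nhds \<tau>. J (x t, y t, z t) =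
      C (x t, y t, z t) * (A a b c (x t) (y t) (z t) * F ((z t - x t) / (z t - y t))
            + 2 * ((x t - y t) * (z t - x t) / (z t - y t)) * deriv F ((z t - x t) / (z t - y t)))"
    using halphen_brioschi_eventually_in(2)[OF sol \<tau> U in_U]
  proof eventually_elim
    case (elim t)
    have regroup: "k * A1 * f + k * (2 * \<kappa> * e) * g = k * (A1 * f + 2 * e * (\<kappa> * g))"
      for k A1 f e \<kappa> g :: complex by (simp add: algebra_simps)
    show ?case
      using J[OF elim] F(2) unfolding B_def regroup by simp
  qed
  show "((\<lambda>t. J (x t, y t, z t)) has_field_derivative 0) (at \<tau>)"
    using J_eq deriv by (rule has_field_derivative_eventually_eq)
qed

text \<open>
  The substitution changes the signs of the exponent differences \<open>1 - c\<close>, \<open>c - a - b\<close> and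
  \<open>a - b\<close>, and the coefficients of \<open>\<Xi>\<close> depend only on their squares.
\<close>

lemma Xi_symmetry: "Xi (1 - a) (1 - b) (2 - c) = Xi a b c"
proof -
  have "coeff_a (1 - a) (1 - b) (2 - c) = coeff_a a b c"
    unfolding coeff_a_def by (simp add: algebra_simps)
  moreover have "coeff_b (1 - a) (1 - b) (2 - c) = coeff_b a b c"
    unfolding coeff_b_def by (simp add: algebra_simps power2_eq_square)
  moreover have "coeff_c (1 - a) (1 - b) (2 - c) = coeff_c a b c"
    unfolding coeff_c_def by (simp add: algebra_simps power2_eq_square)
  ultimately show ?thesis by (simp add: Xi_def fun_eq_iff)
qed

text \<open>
  The second integral is the negative of the first one for the parameters \<open>1 - a\<close>, \<open>1 - b\<close>,
  \<open>2 - c\<close>: the factor \<open>A\<close> changes into minus \<open>A_tilde\<close>, and \<open>1 / (C (z - y))\<close> has the logarithmic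
  derivative \<open>-A / 2 - (z + y)\<close>, which is half of the new \<open>A\<close>.
\<close>

lemma first_integral_J2:
  assumes "nondegenerate (1 - a) (1 - b) (2 - c)"
  shows "first_integral a b c (J2 a b c)"
proof (rule first_integralI)
  fix U J T x y z \<tau>
  assume UJ: "(U, J) \<in> J2 a b c" and sol: "halphen_brioschi a b c T x y z" and \<tau>: "\<tau> \<in> T"
    and in_U: "(x \<tau>, y \<tau>, z \<tau>) \<in> U"
  obtain C p r F G where U: "open U" and C: "C_branch a b c U C"
    and FG: "continued_pair (hyp2F1 (1 - a) (1 - b) (2 - c)) (hyp2F1 (2 - a) (2 - b) (3 - c)) p r F G"
    and J: "\<And>x y z. (x, y, z) \<in> U \<Longrightarrow> (z - x) / (z - y) \<in> ball p r \<and>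
           J (x, y, z) =
             inverse (C (x, y, z)) / (z - y) * A_tilde a b c x y z * F ((z - x) / (z - y)) +
             inverse (C (x, y, z)) / (z - y) * B_tilde a b c x y z * G ((z - x) / (z - y))"
    using UJ unfolding J2_def Let_def by blast
  note Cd = C_branch_log_derivative[OF sol \<tau> U in_U C]
  have sol': "halphen_brioschi (1 - a) (1 - b) (2 - c) T x y z"
    using sol by (simp add: halphen_brioschi_def Xi_symmetry)
  have "1 - a + 1 = 2 - a" "1 - b + 1 = 2 - b" "2 - c + 1 = 3 - c" by simp_all
  with FG have "continued_pair (hyp2F1 (1 - a) (1 - b) (2 - c))
      (hyp2F1 (1 - a + 1) (1 - b + 1) (2 - c + 1)) p r F G" by simp
  note F = continued_hyp2F1[OF assms this]
  let ?C = "\<lambda>t. inverse (C (x t, y t, z t)) / (z t - y t)"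
  have A: "A (1 - a) (1 - b) (2 - c) u v w = - A_tilde a b c u v w" for u v w
    unfolding A_tilde_def A_def by (simp add: algebra_simps)
  have B: "B_tilde a b c u v w = - (2 * ((u - v) * (w - u) / (w - v)) * ((1 - a) * (1 - b) / (2 - c)))"
    for u v w
  proof -
    have "(a - 1) * (b - 1) / (c - 2) = - ((1 - a) * (1 - b) / (2 - c))"
      by (metis minus_diff_eq minus_divide_right mult_minus_left mult_minus_right minus_minus)
    then show ?thesis unfolding B_tilde_def by (simp only: mult_ac mult_minus_left mult_minus_right)
  qed
  have "(?C has_field_derivative ?C \<tau> * (A (1 - a) (1 - b) (2 - c) (x \<tau>) (y \<tau>) (z \<tau>) / 2)) (at \<tau>)"
  proof -
    define X where "X = Xi a b c (x \<tau>) (y \<tau>) (z \<tau>)"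
    have y': "(y has_field_derivative (y \<tau>)\<^sup>2 + X) (at \<tau>)"
      and z': "(z has_field_derivative (z \<tau>)\<^sup>2 + X) (at \<tau>)"
      using sol \<tau> by (auto simp: halphen_brioschi_def X_def)
    define K e where "K = (\<lambda>t. C (x t, y t, z t) * (z t - y t))"
      and "e = A_tilde a b c (x \<tau>) (y \<tau>) (z \<tau>) / 2"
    have K: "K \<tau> \<noteq> 0" using Cd(2,3) by (simp add: K_def)
    have "(K has_field_derivative K \<tau> * e) (at \<tau>)"
      unfolding K_def e_def A_tilde_def
      by (rule derivative_eq_intros Cd(1) y' z' refl)+ (simp add: field_simps power2_eq_square)
    then have "((\<lambda>t. inverse (K t)) has_field_derivative
        - (inverse (K \<tau>) * (K \<tau> * e) * inverse (K \<tau>))) (at \<tau>)"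
      using K by (rule DERIV_inverse')
    moreover have "- (inverse (K \<tau>) * (K \<tau> * e) * inverse (K \<tau>)) = inverse (K \<tau>) * - e"
      using K by (simp add: mult.assoc[symmetric])
    ultimately have K': "((\<lambda>t. inverse (K t)) has_field_derivative inverse (K \<tau>) * - e) (at \<tau>)"
      by (simp only:)
    have C_eq: "?C t = inverse (K t)" for t
      by (simp add: K_def divide_inverse)
    show ?thesis
      unfolding C_eq A using K' by (simp add: e_def)
  qed
  then have "((\<lambda>t. ?C t * (A (1 - a) (1 - b) (2 - c) (x t) (y t) (z t) * F ((z t - x t) / (z t - y t))
            + 2 * ((x t - y t) * (z t - x t) / (z t - y t)) * deriv F ((z t - x t) / (z t - y t))))
          has_field_derivative 0) (at \<tau>)"
    using conserved_quantity[OF sol' \<tau> F(1) open_ball _ Cd(3), where C = ?C] J[OF in_U] by blast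
  then have deriv: "((\<lambda>t. - (?C t * (A (1 - a) (1 - b) (2 - c) (x t) (y t) (z t) * F ((z t - x t) / (z t - y t))
            + 2 * ((x t - y t) * (z t - x t) / (z t - y t)) * deriv F ((z t - x t) / (z t - y t)))))
          has_field_derivative 0) (at \<tau>)"
    using DERIV_minus by fastforce
  have J_eq: "\<forall>\<^sub>F t in nhds \<tau>. J (x t, y t, z t) =
      - (?C t * (A (1 - a) (1 - b) (2 - c) (x t) (y t) (z t) * F ((z t - x t) / (z t - y t))
            + 2 * ((x t - y t) * (z t - x t) / (z t - y t)) * deriv F ((z t - x t) / (z t - y t))))"
    using halphen_brioschi_eventually_in(2)[OF sol \<tau> U in_U]
  proof eventually_elim
    case (elim t)
    have minus: "k * A1 * f + k * - (e * \<kappa>) * g = - (k * (- A1 * f + e * (\<kappa> * g)))"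
      for k A1 f e \<kappa> g :: complex by (simp add: algebra_simps)
    have G: "deriv F ((z t - x t) / (z t - y t)) =
        (1 - a) * (1 - b) / (2 - c) * G ((z t - x t) / (z t - y t))"
      using F(2) J[OF elim] by blast
    show ?case
      unfolding conjunct2[OF J[OF elim]] A B G by (rule minus)
  qed
  show "((\<lambda>t. J (x t, y t, z t)) has_field_derivative 0) (at \<tau>)"
    using J_eq deriv by (rule has_field_derivative_eventually_eq)
qed

section \<open>Gauge transformations of the hypergeometric equation\<close>

lemma open_slit_disc: "open (slit_disc r)"
  unfolding slit_disc_def by (intro open_Diff) auto

lemma slit_disc_in_ball: "s \<in> slit_disc r \<Longrightarrow> s \<in> ball 0 r"
  unfolding slit_disc_def by blast

lemma slit_disc_subset_ball: "slit_disc r \<subseteq> ball 0 r"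
  unfolding slit_disc_def by blast

lemma slit_disc_nonzero: "s \<in> slit_disc r \<Longrightarrow> s \<noteq> 0"
  unfolding slit_disc_def by auto

lemma vanishes_on_slit_disc:
  assumes "0 < r" "f holomorphic_on ball 0 r" "\<And>s. s \<in> slit_disc r \<Longrightarrow> f s = 0" "s \<in> ball 0 r"
  shows "f s = 0"
proof (rule analytic_continuation_open[of "slit_disc r" "ball 0 r" f "\<lambda>_. 0"])
  have "complex_of_real (r / 2) \<in> slit_disc r"
    using assms(1) by (auto simp: slit_disc_def complex_nonpos_Reals_iff)
  then show "slit_disc r \<noteq> {}" by blast
qed (use assms open_slit_disc slit_disc_subset_ball in auto)

text \<open>
  Multiplication by a function \<open>M\<close> with logarithmic derivative \<open>\<mu>\<close> turns the derivative into
  \<open>Y' + \<mu> Y\<close>. The cases needed are \<open>M = s\<^bsup>\<rho>\<^esup>\<close> for the exponents at \<open>0\<close>, and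
  \<open>M = s\<^bsup>1-c\<^esup> (s - 1)\<^bsup>c-a-b\<^esup>\<close>.
\<close>

lemma gauge_derivatives:
  assumes "open S" "Y holomorphic_on S" "s \<in> S"
    and M: "\<forall>s\<in>S. (M has_field_derivative \<mu> s * M s) (at s)"
    and \<mu>: "\<forall>s\<in>S. (\<mu> has_field_derivative \<mu>' s) (at s)"
  shows "deriv (\<lambda>s. M s * Y s) s = M s * (deriv Y s + \<mu> s * Y s)"
    and "deriv (deriv (\<lambda>s. M s * Y s)) s =
      M s * (deriv (deriv Y) s + 2 * \<mu> s * deriv Y s + (\<mu>' s + (\<mu> s)\<^sup>2) * Y s)"
proof -
  have M': "(M has_field_derivative \<mu> s * M s) (at s)"
    and \<mu>': "(\<mu> has_field_derivative \<mu>' s) (at s)"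
    using M \<mu> assms(3) by blast+
  have Y: "(Y has_field_derivative deriv Y t) (at t)"
    "(deriv Y has_field_derivative deriv (deriv Y) t) (at t)" if "t \<in> S" for t
    using that assms(1,2) holomorphic_deriv holomorphic_derivI by blast+
  have d1: "deriv (\<lambda>s. M s * Y s) t = M t * (deriv Y t + \<mu> t * Y t)" if "t \<in> S" for t
    using DERIV_imp_deriv[OF DERIV_mult[OF bspec[OF M that] Y(1)[OF that]]] by (simp add: algebra_simps)
  show "deriv (\<lambda>s. M s * Y s) s = M s * (deriv Y s + \<mu> s * Y s)"
    using d1 assms(3) .
  have "\<forall>\<^sub>F t in nhds s. deriv (\<lambda>s. M s * Y s) t = M t * (deriv Y t + \<mu> t * Y t)"
    using eventually_nhds_in_open[OF assms(1,3)] by eventually_elim (rule d1)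
  then have "deriv (deriv (\<lambda>s. M s * Y s)) s = deriv (\<lambda>t. M t * (deriv Y t + \<mu> t * Y t)) s"
    by (intro deriv_cong_ev) auto
  also have "\<dots> = M s * (deriv (deriv Y) s + 2 * \<mu> s * deriv Y s + (\<mu>' s + (\<mu> s)\<^sup>2) * Y s)"
    by (rule DERIV_imp_deriv, (rule derivative_eq_intros M' Y[OF assms(3)] \<mu>' refl)+)
       (simp add: algebra_simps power2_eq_square)
  finally show "deriv (deriv (\<lambda>s. M s * Y s)) s =
      M s * (deriv (deriv Y) s + 2 * \<mu> s * deriv Y s + (\<mu>' s + (\<mu> s)\<^sup>2) * Y s)" .
qed

lemma common_factor: "p * (k * u) + q * (k * v) + r * (k * w) = k * (p * u + q * v + r * (w::complex))"
  by (simp add: algebra_simps)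

lemma powr_log_derivative:
  assumes "s \<in> slit_disc r"
  shows "((\<lambda>s. s powr \<rho>) has_field_derivative \<rho> / s * s powr \<rho>) (at s)"
proof -
  have "s \<notin> \<real>\<^sub>\<le>\<^sub>0" "s \<noteq> 0" using assms by (auto simp: slit_disc_def)
  then show ?thesis
    using has_field_derivative_powr[of s \<rho>] by (simp add: powr_diff)
qed

section \<open>Absence of logarithms\<close>

text \<open>
  Substituting \<open>s\<^bsup>\<rho>\<^esup> h\<close> and removing the power leaves an equation with polynomial coefficients for
  \<open>h\<close>. It holds on the slit disc, hence on the disc, hence between power series. The coefficient at
  \<open>s\<^sup>0\<close> is the indicial equation.
\<close>

lemma frobenius_recurrence:
  fixes \<rho> :: complex
  assumes r: "0 < r" and h: "h holomorphic_on ball 0 r"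
    and sol: "hypergeometric_sol a b c (slit_disc r) (\<lambda>s. s powr \<rho> * h s)"
  defines "H \<equiv> fps_nth (fps_expansion h 0)"
  shows "\<rho> * (\<rho> + c - 1) * H 0 = 0"
    and "(of_nat (Suc n) + \<rho>) * (of_nat n + \<rho> + c) * H (Suc n)
       = (of_nat n + \<rho> + a) * (of_nat n + \<rho> + b) * H n"
proof -
  let ?h' = "deriv h" and ?h'' = "deriv (deriv h)"
  let ?E = "\<lambda>s. s * (s * (s * ?h'' s)) - s * (s * ?h'' s) + (2 * \<rho> + a + b + 1) * (s * (s * ?h' s))
      - (2 * \<rho> + c) * (s * ?h' s) + ((\<rho> + a) * (\<rho> + b)) * (s * h s) - (\<rho> * (\<rho> + c - 1)) * h s"
  have E0: "?E s = 0" if s: "s \<in> slit_disc r" for s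
  proof -
    have nz: "s \<noteq> 0" "s powr \<rho> \<noteq> 0" using slit_disc_nonzero[OF s] by auto
    define p where "p = inverse s"
    have p: "s * p = 1" using nz by (simp add: p_def)
    have hs: "h holomorphic_on slit_disc r"
      using h slit_disc_subset_ball holomorphic_on_subset by blast
    have M: "\<forall>t\<in>slit_disc r. ((\<lambda>s. s powr \<rho>) has_field_derivative \<rho> / t * t powr \<rho>) (at t)"
      using powr_log_derivative by blast
    have \<mu>: "\<forall>t\<in>slit_disc r. ((\<lambda>s. \<rho> / s) has_field_derivative - \<rho> / t\<^sup>2) (at t)"
      using slit_disc_nonzero
      by (auto intro!: derivative_eq_intros simp: power2_eq_square)
    note d = gauge_derivatives[OF open_slit_disc hs s M \<mu>]
    have "s powr \<rho> * (s * (s - 1) * (?h'' s + 2 * (\<rho> / s) * ?h' s + (- \<rho> / s\<^sup>2 + (\<rho> / s)\<^sup>2) * h s)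
        + ((a + b + 1) * s - c) * (?h' s + \<rho> / s * h s) + a * b * h s) = 0"
    proof -
      have "s * (s - 1) * deriv (deriv (\<lambda>s. s powr \<rho> * h s)) s
          + ((a + b + 1) * s - c) * deriv (\<lambda>s. s powr \<rho> * h s) s + a * b * (s powr \<rho> * h s) = 0"
        using sol s unfolding hypergeometric_sol_def by blast
      then show ?thesis unfolding d common_factor .
    qed
    then have "s * (s * (s - 1) * (?h'' s + 2 * (\<rho> * p) * ?h' s + (- \<rho> * p\<^sup>2 + (\<rho> * p)\<^sup>2) * h s)
        + ((a + b + 1) * s - c) * (?h' s + \<rho> * p * h s) + a * b * h s) = 0"
      using nz by (simp add: p_def divide_inverse power_inverse)
    moreover have "s * (s * (s - 1) * (?h'' s + 2 * (\<rho> * p) * ?h' s + (- \<rho> * p\<^sup>2 + (\<rho> * p)\<^sup>2) * h s)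
        + ((a + b + 1) * s - c) * (?h' s + \<rho> * p * h s) + a * b * h s)
      = s * s * (s - 1) * ?h'' s + 2 * \<rho> * (s * p) * (s * (s - 1)) * ?h' s
        + (\<rho> * \<rho> - \<rho>) * ((s * p) * (s * p)) * (s - 1) * h s
        + ((a + b + 1) * s - c) * (s * ?h' s + \<rho> * (s * p) * h s) + a * b * s * h s"
      by (simp add: algebra_simps power2_eq_square)
    ultimately show ?thesis
      unfolding p by (simp add: algebra_simps)
  qed
  have "?E holomorphic_on ball 0 r"
    by (intro holomorphic_intros h) auto
  then have "?E s = 0" if "s \<in> ball 0 r" for s
    using vanishes_on_slit_disc[OF r, of ?E] E0 that by blast
  then have "\<forall>\<^sub>F s in nhds 0. ?E s = 0"
    using eventually_nhds_in_open[of "ball 0 r" 0] r by (auto elim: eventually_mono)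
  then have "?E has_fps_expansion 0"
    by (simp add: has_fps_expansion_0_iff)
  moreover let ?H = "fps_expansion h 0"
  let ?H' = "fps_deriv ?H" and ?H'' = "fps_deriv (fps_deriv ?H)"
  let ?G = "fps_X * (fps_X * (fps_X * ?H'')) - fps_X * (fps_X * ?H'')
      + fps_const (2 * \<rho> + a + b + 1) * (fps_X * (fps_X * ?H')) - fps_const (2 * \<rho> + c) * (fps_X * ?H')
      + fps_const ((\<rho> + a) * (\<rho> + b)) * (fps_X * ?H) - fps_const (\<rho> * (\<rho> + c - 1)) * ?H"
  have "h has_fps_expansion ?H"
    using r h by (intro has_fps_expansion_fps_expansion[of "ball 0 r"]) auto
  then have "?E has_fps_expansion ?G"
    by (intro fps_expansion_intros)
  ultimately have "?G = 0"
    using fps_expansion_unique_complex by blast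
  then have G: "fps_nth ?G n = 0" for n by simp
  show "\<rho> * (\<rho> + c - 1) * H 0 = 0"
    using G[of 0] by (simp add: H_def)
  show "(of_nat (Suc n) + \<rho>) * (of_nat n + \<rho> + c) * H (Suc n)
       = (of_nat n + \<rho> + a) * (of_nat n + \<rho> + b) * H n"
    using G[of "Suc n"] unfolding H_def[symmetric]
    by (cases n; cases "n - 1") (auto simp: H_def algebra_simps)
qed

text \<open>
  Let \<open>m\<close> be the order of \<open>h\<close> at \<open>0\<close>. The exponent \<open>\<sigma> = m + \<rho>\<close> is \<open>0\<close> or \<open>1 - c\<close>. It is not
  \<open>0\<close>: the recurrence would then make \<open>s\<^bsup>\<rho>\<^esup> h\<close> a multiple of the hypergeometric series. So
  \<open>\<sigma> = 1 - c \<noteq> 0\<close>. If \<open>2 - c = -n\<close>, the recurrence from exponent \<open>\<sigma>\<close> has the factor zero in front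
  of the coefficient with index \<open>n + 1\<close>, so one of the factors \<open>i + \<sigma> + a\<close>, \<open>i + \<sigma> + b\<close> with
  \<open>i \<le> n\<close> vanishes. This is the condition under which the series with parameters \<open>1 - a\<close>,
  \<open>1 - b\<close>, \<open>2 - c\<close> breaks off in time.
\<close>

lemma no_log_imp:
  assumes c: "c \<notin> \<int>\<^sub>\<le>\<^sub>0" and "no_log_at_0 a b c"
  shows "c \<noteq> 1" and "nondegenerate (1 - a) (1 - b) (2 - c)"
proof -
  have c_nz: "c + of_nat n \<noteq> 0" for n
    using c plus_of_nat_eq_0_imp by blast
  obtain \<rho> h r where r: "0 < r" "r \<le> 1" and h: "h holomorphic_on ball 0 r"
    and sec: "second_solution a b c (slit_disc r) (\<lambda>s. s powr \<rho> * h s)"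
    using assms(2) unfolding no_log_at_0_def by blast
  then have sol: "hypergeometric_sol a b c (slit_disc r) (\<lambda>s. s powr \<rho> * h s)"
    and indep: "\<And>\<alpha> \<beta>. (\<And>s. s \<in> slit_disc r \<Longrightarrow> \<alpha> * hyp2F1 a b c s + \<beta> * (s powr \<rho> * h s) = 0)
      \<Longrightarrow> \<alpha> = 0 \<and> \<beta> = 0"
    unfolding second_solution_def by blast+
  define H where "H = fps_nth (fps_expansion h 0)"
  note rec = frobenius_recurrence[OF r(1) h sol, folded H_def]
  have h_exp: "h has_fps_expansion fps_expansion h 0"
    using r h by (intro has_fps_expansion_fps_expansion[of "ball 0 r"]) auto
  have "\<exists>n. H n \<noteq> 0"
  proof (rule ccontr)
    assume "\<not> (\<exists>n. H n \<noteq> 0)"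
    then have "fps_expansion h 0 = 0" by (simp add: H_def fps_eq_iff)
    with h_exp have "h has_fps_expansion 0" by simp
    then have "h s = 0" if "s \<in> slit_disc r" for s
      using slit_disc_in_ball[OF that] r
      by (intro has_fps_expansion_0_analytic_continuation[of h "ball 0 r"] h) auto
    then show False using indep[of 0 1] by simp
  qed
  define m where "m = (LEAST n. H n \<noteq> 0)"
  have Hm: "H m \<noteq> 0" and below: "\<And>n. n < m \<Longrightarrow> H n = 0"
    using LeastI_ex[OF \<open>\<exists>n. H n \<noteq> 0\<close>] not_less_Least unfolding m_def by blast+
  define \<sigma> where "\<sigma> = of_nat m + \<rho>"
  have indicial: "\<sigma> * (\<sigma> + c - 1) = 0"
  proof (cases m)
    case 0
    then show ?thesis using rec(1) Hm by (simp add: \<sigma>_def)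
  next
    case (Suc l)
    then have "H l = 0" using below by simp
    then show ?thesis using rec(2)[of l] Hm Suc by (auto simp: \<sigma>_def add_ac)
  qed
  have rec_\<sigma>: "(of_nat (Suc n) + \<sigma>) * (of_nat n + \<sigma> + c) * H (m + Suc n)
       = (of_nat n + \<sigma> + a) * (of_nat n + \<sigma> + b) * H (m + n)" for n
    using rec(2)[of "m + n"] by (simp add: \<sigma>_def add_ac)
  have "\<sigma> \<noteq> 0"
  proof
    assume "\<sigma> = 0"
    then have rho: "\<rho> = - of_nat m" unfolding \<sigma>_def by (simp add: eq_neg_iff_add_eq_0 add.commute)
    let ?u = "fps_nth (fps_hypergeo [a, b] [c] 1)"
    have H_shift: "H (m + n) = H m * ?u n" for n
    proof (induction n)
      case (Suc n)
      have "of_nat (Suc n) \<noteq> (0::complex)" by (rule of_nat_neq_0)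
      moreover have "H (m + Suc n) * (of_nat (Suc n) * (c + of_nat n))
          = (a + of_nat n) * (b + of_nat n) * H (m + n)"
        using rec_\<sigma>[of n] unfolding \<open>\<sigma> = 0\<close> by (simp only: add_0_left add_0_right mult_ac add_ac)
      ultimately have "H (m + Suc n) =
          (a + of_nat n) * (b + of_nat n) / (of_nat (Suc n) * (c + of_nat n)) * H (m + n)"
        using c_nz[of n] by (simp add: nonzero_eq_divide_eq del: of_nat_Suc)
      then show ?case using Suc unfolding hypergeo_recurrence by simp
    qed simp
    have "fps_expansion h 0 = fps_X ^ m * (fps_const (H m) * fps_hypergeo [a, b] [c] 1)"
    proof (rule fps_ext)
      fix n
      show "fps_nth (fps_expansion h 0) n =
          fps_nth (fps_X ^ m * (fps_const (H m) * fps_hypergeo [a, b] [c] 1)) n"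
        using below[of n] H_shift[of "n - m"]
        by (cases "n < m") (auto simp: H_def[symmetric] fps_X_power_mult_nth)
    qed
    then have "(\<lambda>s. h s - s ^ m * (H m * hyp2F1 a b c s)) has_fps_expansion 0"
      using has_fps_expansion_diff[OF h_exp
          has_fps_expansion_mult[OF has_fps_expansion_fps_X_power[of m]
            has_fps_expansion_cmult_left[OF has_fps_expansion_hyp2F1[of a b c], of "H m"]]]
      by simp
    moreover have "(\<lambda>s. h s - s ^ m * (H m * hyp2F1 a b c s)) holomorphic_on ball 0 r"
      using r by (intro holomorphic_intros h holomorphic_on_subset[OF holomorphic_on_hyp2F1]) auto
    ultimately have h_eq: "h s - s ^ m * (H m * hyp2F1 a b c s) = 0" if "s \<in> slit_disc r" for s
      using slit_disc_in_ball[OF that] r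
      by (intro has_fps_expansion_0_analytic_continuation[of _ "ball 0 r"]) auto
    have "H m * hyp2F1 a b c s + (- 1) * (s powr \<rho> * h s) = 0" if "s \<in> slit_disc r" for s
    proof -
      have "s \<noteq> 0" using slit_disc_nonzero that .
      then have "s powr \<rho> * s ^ m = 1"
        unfolding rho by (simp add: powr_minus powr_nat)
      then have "s powr \<rho> * h s = H m * hyp2F1 a b c s"
        using h_eq[OF that] by (simp add: mult.assoc[symmetric])
      then show ?thesis by simp
    qed
    from indep[OF this] show False by simp
  qed
  with indicial have "\<sigma> + c - 1 = 0" by simp
  then have \<sigma>: "\<sigma> = 1 - c" by (simp add: algebra_simps)
  with \<open>\<sigma> \<noteq> 0\<close> show "c \<noteq> 1" by simp
  show "nondegenerate (1 - a) (1 - b) (2 - c)"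
    unfolding nondegenerate_def
  proof (intro allI impI, rule ccontr)
    fix n assume n: "2 - c = - of_nat n"
      and no: "\<not> (\<exists>k\<le>n. 1 - a = - of_nat k \<or> 1 - b = - of_nat k)"
    have c_eq: "c = of_nat n + 2" using n by (simp add: algebra_simps)
    have factors: "of_nat i + \<sigma> + a \<noteq> 0" "of_nat i + \<sigma> + b \<noteq> 0" if "i \<le> n" for i
    proof -
      \<comment> \<open>Since \<open>\<sigma> = - n - 1\<close>, the factor \<open>i + \<sigma> + a\<close> is \<open>-(1 - a) - (n - i)\<close>.\<close>
      have "1 - a \<noteq> - of_nat (n - i)" "1 - b \<noteq> - of_nat (n - i)" using no by auto
      then show "of_nat i + \<sigma> + a \<noteq> 0" "of_nat i + \<sigma> + b \<noteq> 0"
        using that by (auto simp: \<sigma> c_eq of_nat_diff algebra_simps add_eq_0_iff)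
    qed
    have "H (m + i) \<noteq> 0" if "i \<le> Suc n" for i
      using that
    proof (induction i)
      case (Suc i)
      then show ?case using rec_\<sigma>[of i] factors[of i] by auto
    qed (use Hm in simp)
    moreover have "of_nat (Suc n) + \<sigma> = 0" by (simp add: \<sigma> c_eq)
    ultimately show False
      using rec_\<sigma>[of n] factors[of n] by auto
  qed
qed

section \<open>The second solution\<close>

text \<open>
  In the equation for \<open>Y\<close> the double poles of \<open>\<mu>' + \<mu>\<^sup>2\<close> at \<open>0\<close> and \<open>1\<close> cancel against the poles
  that \<open>\<mu>\<close> contributes to the first-order term, as \<open>1 - c\<close> and \<open>c - a - b\<close> are exponents there.
\<close>

lemma gauge_transformed_sol:
  assumes Y: "hypergeometric_sol (1 - a) (1 - b) (2 - c) (ball 0 1) Y"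
    and L: "continuous_on (ball 0 1) L" "\<And>s. s \<in> ball 0 1 \<Longrightarrow> exp (L s) = s - 1"
  shows "L holomorphic_on ball 0 1"
    and "hypergeometric_sol a b c (slit_disc 1)
           (\<lambda>s. s powr (1 - c) * exp ((c - a - b) * L s) * Y s)"
proof -
  have L': "(L has_field_derivative 1 / (s - 1)) (at s)" if "s \<in> ball 0 1" for s
  proof (rule has_field_derivative_continuous_log)
    show "\<forall>\<^sub>F t in nhds s. exp (L t) = t - 1"
      using eventually_nhds_in_open[OF open_ball that] by eventually_elim (rule L(2))
    show "isCont L s"
      using L(1) that by (simp add: continuous_on_eq_continuous_at)
  qed (auto intro!: derivative_eq_intros)
  then show Lhol: "L holomorphic_on ball 0 1"
    unfolding holomorphic_on_open[OF open_ball] by blast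
  define \<kappa> where "\<kappa> = c - a - b"
  let ?S = "slit_disc 1"
  let ?M = "\<lambda>s. s powr (1 - c) * exp (\<kappa> * L s)"
  let ?\<mu> = "\<lambda>s. (1 - c) / s + \<kappa> / (s - 1)"
  let ?\<mu>' = "\<lambda>s. - (1 - c) / s\<^sup>2 - \<kappa> / (s - 1)\<^sup>2"
  have in_ball: "s \<in> ball 0 1" "s \<noteq> 0" "s \<noteq> 1" if "s \<in> ?S" for s
    using that slit_disc_subset_ball slit_disc_nonzero by fastforce+
  have M: "\<forall>s\<in>?S. (?M has_field_derivative ?\<mu> s * ?M s) (at s)"
  proof
    fix s assume that: "s \<in> ?S"
    show "(?M has_field_derivative ?\<mu> s * ?M s) (at s)"
      by (rule derivative_eq_intros powr_log_derivative[OF that] L'[OF in_ball(1)[OF that]] refl)+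
         (simp add: algebra_simps)
  qed
  have \<mu>: "\<forall>s\<in>?S. (?\<mu> has_field_derivative ?\<mu>' s) (at s)"
    using in_ball(2,3)
    by (auto intro!: derivative_eq_intros simp: power2_eq_square)
  have Yhol: "Y holomorphic_on ball 0 1" using Y by (simp add: hypergeometric_sol_def)
  then have YS: "Y holomorphic_on ?S"
    using slit_disc_subset_ball holomorphic_on_subset by blast
  have "s * (s - 1) * deriv (deriv (\<lambda>s. ?M s * Y s)) s
      + ((a + b + 1) * s - c) * deriv (\<lambda>s. ?M s * Y s) s + a * b * (?M s * Y s) = 0"
    if s: "s \<in> ?S" for s
  proof -
    note d = gauge_derivatives[OF open_slit_disc YS s M \<mu>]
    define Y0 Y1 Y2 where "Y0 = Y s" and "Y1 = deriv Y s" and "Y2 = deriv (deriv Y) s"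
    \<comment> \<open>With \<open>p\<close> and \<open>q\<close> as variables the cancellation of poles is a polynomial identity modulo
      \<open>s p = 1\<close> and \<open>(s - 1) q = 1\<close>.\<close>
    define p q where "p = inverse s" and "q = inverse (s - 1)"
    have p: "s * p = 1" and q: "(s - 1) * q = 1" using in_ball[OF s] by (simp_all add: p_def q_def)
    have ode: "s * (s - 1) * Y2 + ((1 - a + (1 - b) + 1) * s - (2 - c)) * Y1 + (1 - a) * (1 - b) * Y0 = 0"
      using Y in_ball[OF s] unfolding hypergeometric_sol_def Y0_def Y1_def Y2_def by blast
    have \<mu>_eq: "?\<mu> s = (1 - c) * p + \<kappa> * q" "?\<mu>' s = - (1 - c) * p\<^sup>2 - \<kappa> * q\<^sup>2"
      by (simp_all add: p_def q_def divide_inverse power_inverse)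
    have Y1_coeff: "2 * (s * (s - 1)) * ((1 - c) * p + \<kappa> * q) + ((a + b + 1) * s - c)
        = (1 - a + (1 - b) + 1) * s - (2 - c)"
    proof -
      have "2 * (s * (s - 1)) * ((1 - c) * p + \<kappa> * q)
          = 2 * (1 - c) * (s * p) * (s - 1) + 2 * \<kappa> * s * ((s - 1) * q)"
        by (simp add: algebra_simps)
      then show ?thesis unfolding p q \<kappa>_def by (simp add: algebra_simps)
    qed
    have Y0_coeff: "s * (s - 1) * (- (1 - c) * p\<^sup>2 - \<kappa> * q\<^sup>2 + ((1 - c) * p + \<kappa> * q)\<^sup>2)
        + ((a + b + 1) * s - c) * ((1 - c) * p + \<kappa> * q) + a * b = (1 - a) * (1 - b)"
    proof -
      have e1: "s * (s - 1) * (- (1 - c) * p\<^sup>2 - \<kappa> * q\<^sup>2 + ((1 - c) * p + \<kappa> * q)\<^sup>2)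
        = - c * (1 - c) * (s * p) * (s * p - p) + 2 * (1 - c) * \<kappa> * ((s * p) * ((s - 1) * q))
          + \<kappa> * (\<kappa> - 1) * ((s - 1) * q) * ((s - 1) * q + q)"
        by (simp add: algebra_simps power2_eq_square)
      have e2: "((a + b + 1) * s - c) * ((1 - c) * p + \<kappa> * q)
        = (1 - c) * ((a + b + 1) * (s * p) - c * p)
          + \<kappa> * ((a + b + 1) * ((s - 1) * q) + (a + b + 1 - c) * q)"
        by (simp add: algebra_simps)
      show ?thesis unfolding e1 e2 unfolding p q \<kappa>_def by (simp add: algebra_simps)
    qed
    have "s * (s - 1) * (Y2 + 2 * ((1 - c) * p + \<kappa> * q) * Y1
          + (- (1 - c) * p\<^sup>2 - \<kappa> * q\<^sup>2 + ((1 - c) * p + \<kappa> * q)\<^sup>2) * Y0)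
        + ((a + b + 1) * s - c) * (Y1 + ((1 - c) * p + \<kappa> * q) * Y0) + a * b * Y0
      = s * (s - 1) * Y2
        + (2 * (s * (s - 1)) * ((1 - c) * p + \<kappa> * q) + ((a + b + 1) * s - c)) * Y1
        + (s * (s - 1) * (- (1 - c) * p\<^sup>2 - \<kappa> * q\<^sup>2 + ((1 - c) * p + \<kappa> * q)\<^sup>2)
          + ((a + b + 1) * s - c) * ((1 - c) * p + \<kappa> * q) + a * b) * Y0"
      by (simp only: distrib_left distrib_right mult_ac add_ac)
    also have "\<dots> = 0"
      unfolding Y1_coeff Y0_coeff ode ..
    finally show ?thesis
      unfolding d common_factor unfolding \<mu>_eq Y0_def Y1_def Y2_def by simp
  qed
  moreover have "(\<lambda>s. ?M s * Y s) holomorphic_on ?S"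
  proof -
    have "?M holomorphic_on ?S"
      unfolding holomorphic_on_open[OF open_slit_disc] using M by blast
    then show ?thesis using YS by (rule holomorphic_on_mult)
  qed
  ultimately show "hypergeometric_sol a b c (slit_disc 1)
           (\<lambda>s. s powr (1 - c) * exp ((c - a - b) * L s) * Y s)"
    unfolding hypergeometric_sol_def \<kappa>_def by blast
qed

text \<open>
  Eliminating \<open>s\<^bsup>\<rho>\<^esup>\<close> between the relation and its derivative, as in a Wronskian, gives a
  relation between functions that are holomorphic at \<open>0\<close>. Its value at \<open>0\<close> is
  \<open>- \<alpha> \<rho> P(0) Q(0)\<close>, whether or not \<open>\<rho>\<close> is an integer.
\<close>

lemma independent_of_powr:
  assumes "0 < r" and P: "P holomorphic_on ball 0 r" and Q: "Q holomorphic_on ball 0 r"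
    and "P 0 \<noteq> 0" "Q 0 \<noteq> 0" "\<rho> \<noteq> 0"
    and zero: "\<And>s. s \<in> slit_disc r \<Longrightarrow> \<alpha> * P s + \<beta> * (s powr \<rho> * Q s) = 0"
  shows "\<alpha> = 0 \<and> \<beta> = 0"
proof -
  let ?W = "\<lambda>s. \<alpha> * (s * deriv P s * Q s - P s * (s * deriv Q s + \<rho> * Q s))"
  have "?W s = 0" if s: "s \<in> slit_disc r" for s
  proof -
    have nz: "s \<noteq> 0" using slit_disc_nonzero[OF s] .
    have s_ball: "s \<in> ball 0 r" using s slit_disc_subset_ball by blast
    have "((\<lambda>s. \<alpha> * P s + \<beta> * (s powr \<rho> * Q s)) has_field_derivative
        \<alpha> * deriv P s + \<beta> * (\<rho> / s * s powr \<rho> * Q s + s powr \<rho> * deriv Q s)) (at s)"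
      by (rule derivative_eq_intros powr_log_derivative[OF s]
          holomorphic_derivI[OF P open_ball s_ball] holomorphic_derivI[OF Q open_ball s_ball] refl)+
         (simp add: algebra_simps)
    moreover have "((\<lambda>s. \<alpha> * P s + \<beta> * (s powr \<rho> * Q s)) has_field_derivative 0) (at s)"
      by (rule has_field_derivative_transform_within_open[OF DERIV_const open_slit_disc s])
         (use zero in simp)
    ultimately have "\<alpha> * deriv P s + \<beta> * (\<rho> / s * s powr \<rho> * Q s + s powr \<rho> * deriv Q s) = 0"
      by (rule DERIV_unique)
    then have "s * (\<alpha> * deriv P s + \<beta> * (\<rho> / s * s powr \<rho> * Q s + s powr \<rho> * deriv Q s)) = 0"
      by simp
    then have 1: "\<alpha> * (s * deriv P s) + \<beta> * s powr \<rho> * (s * deriv Q s + \<rho> * Q s) = 0"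
      using nz by (simp add: algebra_simps)
    have 2: "\<beta> * s powr \<rho> * Q s = - (\<alpha> * P s)"
      using zero[OF s] by (simp add: add_eq_0_iff mult.assoc)
    have "?W s = Q s * (\<alpha> * (s * deriv P s) + \<beta> * s powr \<rho> * (s * deriv Q s + \<rho> * Q s))
        - (s * deriv Q s + \<rho> * Q s) * (\<beta> * s powr \<rho> * Q s + \<alpha> * P s)"
      by (simp add: algebra_simps)
    then show ?thesis unfolding 1 2 by simp
  qed
  moreover have "?W holomorphic_on ball 0 r"
    by (intro holomorphic_intros P Q) auto
  ultimately have "?W 0 = 0"
    using vanishes_on_slit_disc[OF assms(1), of ?W 0] assms(1) by simp
  then have \<alpha>: "\<alpha> = 0" using assms(4-6) by simp
  have "\<beta> = 0"
  proof (rule ccontr)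
    assume "\<beta> \<noteq> 0"
    with \<alpha> zero have "Q s = 0" if "s \<in> slit_disc r" for s
      using that slit_disc_nonzero by fastforce
    then have "Q 0 = 0"
      using vanishes_on_slit_disc[OF assms(1) Q, of 0] assms(1) by simp
    with assms(5) show False by simp
  qed
  with \<alpha> show ?thesis by simp
qed

lemma second_solution_hyp2F1:
  assumes "c \<noteq> 1" "nondegenerate (1 - a) (1 - b) (2 - c)"
    and L: "continuous_on (ball 0 1) L" "\<And>s. s \<in> ball 0 1 \<Longrightarrow> exp (L s) = s - 1"
  shows "second_solution a b c (slit_disc 1)
    (\<lambda>s. s powr (1 - c) * exp ((c - a - b) * L s) * hyp2F1 (1 - a) (1 - b) (2 - c) s)"
  unfolding second_solution_def
proof (intro conjI allI impI)
  note trafo = gauge_transformed_sol[OF hypergeometric_sol_hyp2F1[OF assms(2)] L]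
  show "hypergeometric_sol a b c (slit_disc 1)
      (\<lambda>s. s powr (1 - c) * exp ((c - a - b) * L s) * hyp2F1 (1 - a) (1 - b) (2 - c) s)"
    by (rule trafo(2))
  fix \<alpha> \<beta>
  assume zero: "\<forall>s\<in>slit_disc 1. \<alpha> * hyp2F1 a b c s + \<beta> *
      (s powr (1 - c) * exp ((c - a - b) * L s) * hyp2F1 (1 - a) (1 - b) (2 - c) s) = 0"
  have "\<alpha> = 0 \<and> \<beta> = 0"
  proof (rule independent_of_powr[where r = 1 and \<rho> = "1 - c" and P = "hyp2F1 a b c"
        and Q = "\<lambda>s. exp ((c - a - b) * L s) * hyp2F1 (1 - a) (1 - b) (2 - c) s"])
    show "(\<lambda>s. exp ((c - a - b) * L s) * hyp2F1 (1 - a) (1 - b) (2 - c) s) holomorphic_on ball 0 1"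
      by (intro holomorphic_intros trafo(1) holomorphic_on_hyp2F1)
  qed (use assms(1) zero in \<open>auto simp: hyp2F1_0 holomorphic_on_hyp2F1 mult.assoc\<close>)
  then show "\<alpha> = 0" "\<beta> = 0" by simp_all
qed

section \<open>The first integrals of the system\<close>

theorem mainTheorem16:
  fixes a b c :: complex
  assumes "c \<notin> \<int>\<^sub>\<le>\<^sub>0"
  shows "first_integral a b c (J1 a b c) \<and>
    (no_log_at_0 a b c \<longrightarrow>
      (\<forall>L. continuous_on (ball 0 1) L \<and> (\<forall>s\<in>ball 0 1. exp (L s) = s - 1) \<longrightarrow>
         second_solution a b c (slit_disc 1)
           (\<lambda>s. s powr (1 - c) * exp ((c - a - b) * L s) * hyp2F1 (1 - a) (1 - b) (2 - c) s)) \<and>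
      first_integral a b c (J2 a b c))"
proof (intro conjI impI allI; (elim conjE)?)
  have "nondegenerate a b c"
    unfolding nondegenerate_def using assms by auto
  then show "first_integral a b c (J1 a b c)"
    by (rule first_integral_J1)
next
  fix L :: "complex \<Rightarrow> complex"
  assume "no_log_at_0 a b c" "continuous_on (ball 0 1) L" "\<forall>s\<in>ball 0 1. exp (L s) = s - 1"
  then show "second_solution a b c (slit_disc 1)
      (\<lambda>s. s powr (1 - c) * exp ((c - a - b) * L s) * hyp2F1 (1 - a) (1 - b) (2 - c) s)"
    using no_log_imp[OF assms] second_solution_hyp2F1 by blast
next
  assume "no_log_at_0 a b c"
  then show "first_integral a b c (J2 a b c)"
    using no_log_imp[OF assms] first_integral_J2 by blast
qed

end
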